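(* Let $n\ge 2$ and $m\ge 1$ be integers. Let $\Omega\subseteq\mathbb{R}^n$ be an open, bounded and connected set with $0\in\Omega$ which is convex in the $x_1$-direction and symmetric with respect to the hyperplane $\{x_1=0\}$. Let $f:[0,+\infty)\to\mathbb{R}$ be (globally) Lipschitz continuous and non-decreasing, with $f(0)\ge 0$. Let $u\in C^{2m}(\Omega\setminus\{0\})\cap C^{2m-2}(\overline{\Omega}\setminus\{0\})$ be a real-valued classical solution of the boundary value problem $$\begin{cases}(-\Delta)^m u=f(u) & \text{in }\Omega\setminus\{0\},\\ u>0 & \text{in }\Omega\setminus\{0\},\\ u=-\Delta u=\cdots=(-\Delta)^{m-1}u=0 & \text{on }\partial\Omega,\\ \inf_{\Omega\setminus\{0\}}(-\Delta)^j u>-\infty & \text{for } j=1,\ldots,m-1.\end{cases}$$ Then: (1) $u$ is symmetric in $x_1$, i.e. $u(x_1,x_2,\ldots,x_n)=u(-x_1,x_2,\ldots,x_n)$ for every $x=(x_1,\ldots,x_n)\in\Omega\setminus\{0\}$; (2) $u$ is decreasing with respect to $x_1$ on $\Omega\cap\{x_1>0\}$.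
   Context: $\Omega$ is convex in the $x_1$-direction if, whenever $p=(p_1,\dots,p_n)$ and $q=(q_1,\dots,q_n)$ belong to $\Omega$ and $p_j=q_j$ for all $j\in\{2,\dots,n\}$, the point $(1-t)p+tq$ belongs to $\Omega$ for all $t\in[0,1]$. $\Omega$ is symmetric with respect to $\{x_1=0\}$ if $(p_1,p_2,\dots,p_n)\in\Omega$ implies $(-p_1,p_2,\dots,p_n)\in\Omega$. No regularity of $\partial\Omega$ is assumed. When $m=1$ the last condition in the boundary value problem is void. *)

theory Defs
  imports "HOL-Analysis.Analysis"
begin

text \<open>Points of n-dimensional space have type \<^typ>\<open>real ^ 'n\<close>. An index type has no
  distinguished element, so an arbitrary index \<open>k\<close> plays the role of the first coordinate.\<close>

definition convex_in_direction :: "'n::finite \<Rightarrow> (real ^ 'n) set \<Rightarrow> bool" where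
  "convex_in_direction k \<Omega> \<longleftrightarrow>
     (\<forall>p\<in>\<Omega>. \<forall>q\<in>\<Omega>. (\<forall>j. j \<noteq> k \<longrightarrow> p $ j = q $ j) \<longrightarrow>
        (\<forall>t\<in>{0..1}. (1 - t) *\<^sub>R p + t *\<^sub>R q \<in> \<Omega>))"

definition reflect :: "'n::finite \<Rightarrow> real ^ 'n \<Rightarrow> real ^ 'n" where
  "reflect k x = (\<chi> i. if i = k then - (x $ i) else x $ i)"

definition symmetric_in_direction :: "'n::finite \<Rightarrow> (real ^ 'n) set \<Rightarrow> bool" where
  "symmetric_in_direction k \<Omega> \<longleftrightarrow> (\<forall>p\<in>\<Omega>. reflect k p \<in> \<Omega>)"

definition partial_deriv :: "'n::finite \<Rightarrow> (real ^ 'n \<Rightarrow> real) \<Rightarrow> real ^ 'n \<Rightarrow> real" where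
  "partial_deriv i u x = deriv (\<lambda>t. u (x + t *\<^sub>R axis i 1)) 0"

fun partials :: "'n::finite list \<Rightarrow> (real ^ 'n \<Rightarrow> real) \<Rightarrow> real ^ 'n \<Rightarrow> real" where
  "partials [] u = u"
| "partials (i # is) u = partial_deriv i (partials is u)"

definition neg_laplacian :: "(real ^ 'n::finite \<Rightarrow> real) \<Rightarrow> real ^ 'n \<Rightarrow> real" where
  "neg_laplacian u x = - (\<Sum>i\<in>UNIV. partial_deriv i (partial_deriv i u) x)"

text \<open>The class \<open>C\<^sup>k(U)\<close> for open \<open>U\<close>. Differentiability is required explicitly because
  \<^const>\<open>deriv\<close> is total.\<close>

definition Ck_on :: "nat \<Rightarrow> (real ^ 'n::finite) set \<Rightarrow> (real ^ 'n \<Rightarrow> real) \<Rightarrow> bool" where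
  "Ck_on k U u \<longleftrightarrow>
     (\<forall>is. length is < k \<longrightarrow>
        (\<forall>i. \<forall>x\<in>U. (\<lambda>t. partials is u (x + t *\<^sub>R axis i 1)) differentiable (at 0))) \<and>
     (\<forall>is. length is \<le> k \<longrightarrow> continuous_on U (partials is u))"

text \<open>The extension of \<open>v\<close> from \<open>U\<close> by limits; it is the continuous extension of \<open>v\<close> to a
  subset of the closure of \<open>U\<close> whenever \<open>U\<close> is open and a continuous extension exists.\<close>

definition cont_ext :: "(real ^ 'n::finite) set \<Rightarrow> (real ^ 'n \<Rightarrow> real) \<Rightarrow> real ^ 'n \<Rightarrow> real" where
  "cont_ext U v x = (if x \<in> U then v x else Lim (at x within U) v)"

text \<open>The class \<open>C\<^sup>k(T)\<close> for \<open>U \<subseteq> T \<subseteq> closure U\<close> with \<open>U\<close> open: all partial derivatives of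
  order at most \<open>k\<close> in \<open>U\<close> extend continuously to \<open>T\<close>. Continuity of \<open>u\<close> itself on \<open>T\<close> says
  that the values of \<open>u\<close> on \<open>T - U\<close> are those of its extension.\<close>

definition Ck_upto :: "nat \<Rightarrow> (real ^ 'n::finite) set \<Rightarrow> (real ^ 'n) set \<Rightarrow> (real ^ 'n \<Rightarrow> real) \<Rightarrow> bool" where
  "Ck_upto k U T u \<longleftrightarrow>
     Ck_on k U u \<and> continuous_on T u \<and>
     (\<forall>is. length is \<le> k \<longrightarrow> continuous_on T (cont_ext U (partials is u)))"

end

theory Submission
  imports Defs
begin

text \<open>
  The method of moving planes applies to the functions \<open>U j = (-\<Delta>)^j u\<close>, \<open>j < m\<close>, which solve
  the second order system \<open>-\<Delta> (U j) = U (j + 1)\<close> with \<open>U m = f \<circ> U 0\<close>. For \<open>\<mu> > 0\<close> compare \<open>U j\<close>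
  with its reflection in the hyperplane \<open>x $ k = \<mu>\<close>: the differences \<open>W \<mu> j\<close>, reflected minus
  original, live on the cap of points of \<open>\<Omega>\<close> beyond the hyperplane, with the reflected
  singularity removed. They solve the same kind of system, and because \<open>f\<close> is nondecreasing and
  Lipschitz a lower bound \<open>-M\<close> for \<open>W \<mu> 0\<close> gives the lower bound \<open>-L M\<close> for the last right hand
  side. Both claims follow once \<open>W \<mu> 0\<close> is nonnegative on the cap, and in fact positive, for
  every \<open>\<mu> > 0\<close>: positivity is strict monotonicity, and \<open>\<mu> \<rightarrow> 0\<close> compares \<open>u\<close> with its mirror
  image, in both directions since the mirror image solves the same problem.

  All comparisons rest on one maximum principle (\<open>maximum_principle\<close>): a function which is bounded
  below, has nonnegative lower limits at the boundary except perhaps at one point, and satisfies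
  \<open>\<Delta> w \<le> A\<close> where it is negative, is at least \<open>- 2 A T\<close>, where \<open>T\<close> can be taken small if the set
  \<open>{w < 0}\<close> has small volume. The one exceptional point is harmless because \<open>-ln |x|\<close> is
  superharmonic and infinite at \<open>0\<close> in every dimension at least two. The dependence on the volume
  comes from comparison with a solution of the heat equation which is a finite sum of Gaussians: it starts above the negative part of \<open>w\<close>, and after time
  \<open>T\<close> it is at most a constant times \<open>T^(-n/2)\<close> times the volume.

  Applied down the system, the principle yields \<open>W_lower_bounds\<close> and hence \<open>small_negative_set\<close>:
  if \<open>{W \<mu> 0 < 0}\<close> has volume below a threshold independent of \<open>\<mu>\<close>, it is empty. If \<open>W \<mu> 0\<close> is
  nonnegative it is superharmonic and therefore positive (\<open>W_positive\<close>): from a zero one could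
  travel along the axis direction to the boundary, where \<open>u\<close> vanishes, with reflected points
  tending to an interior point, where \<open>u\<close> is positive. Finally (\<open>W_nonneg\<close>) there is no bad
  \<open>\<mu>\<close>, one with negative values of \<open>W \<mu> 0\<close>. At the supremum \<open>\<mu>0\<close> of the bad values \<open>W \<mu>0 0\<close> is nonnegative by continuity,
  hence positive, hence bounded away from zero on a compact part of the cap of almost full
  volume. For \<open>\<mu>\<close> slightly below \<open>\<mu>0\<close> only a set of small volume is left for \<open>W \<mu> 0\<close> to be
  negative on.
\<close>

section \<open>Pointwise Laplacians\<close>

text \<open>Second derivatives at one point and without continuity are all that the maximum principle
  uses. Stating them along coordinate lines makes them directly comparable with the iterated
  partial derivatives of the problem and invariant under reflection of a coordinate.\<close>
definition has_second_deriv :: "(real \<Rightarrow> real) \<Rightarrow> real \<Rightarrow> bool" where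
  "has_second_deriv g d \<longleftrightarrow>
     (\<exists>g'. (\<forall>\<^sub>F t in nhds 0. (g has_real_derivative g' t) (at t)) \<and>
           (g' has_real_derivative d) (at 0))"

definition has_laplacian :: "(real ^ 'n::finite \<Rightarrow> real) \<Rightarrow> real ^ 'n \<Rightarrow> real \<Rightarrow> bool" where
  "has_laplacian v x l \<longleftrightarrow>
     (\<exists>d. (\<forall>i. has_second_deriv (\<lambda>t. v (x + t *\<^sub>R axis i 1)) (d i)) \<and> l = (\<Sum>i\<in>UNIV. d i))"

lemma has_second_deriv_add:
  assumes "has_second_deriv g d" "has_second_deriv h e"
  shows "has_second_deriv (\<lambda>t. g t + h t) (d + e)"
proof -
  obtain g' h' where
    "\<forall>\<^sub>F t in nhds 0. (g has_real_derivative g' t) (at t)" "(g' has_real_derivative d) (at 0)"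
    "\<forall>\<^sub>F t in nhds 0. (h has_real_derivative h' t) (at t)" "(h' has_real_derivative e) (at 0)"
    using assms unfolding has_second_deriv_def by auto
  then show ?thesis unfolding has_second_deriv_def
    by (intro exI[of _ "\<lambda>t. g' t + h' t"] conjI)
      (auto elim: eventually_elim2 intro!: derivative_intros)
qed

lemma has_second_deriv_cmult:
  assumes "has_second_deriv g d"
  shows "has_second_deriv (\<lambda>t. c * g t) (c * d)"
proof -
  obtain g' where
    "\<forall>\<^sub>F t in nhds 0. (g has_real_derivative g' t) (at t)" "(g' has_real_derivative d) (at 0)"
    using assms unfolding has_second_deriv_def by auto
  then show ?thesis unfolding has_second_deriv_def
    by (intro exI[of _ "\<lambda>t. c * g' t"] conjI)
      (auto elim!: eventually_mono intro!: DERIV_cmult)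
qed

lemma has_second_deriv_flip:
  assumes "has_second_deriv g d"
  shows "has_second_deriv (\<lambda>t. g (- t)) d"
proof -
  obtain g' where g':
    "\<forall>\<^sub>F t in nhds 0. (g has_real_derivative g' t) (at t)" "(g' has_real_derivative d) (at 0)"
    using assms unfolding has_second_deriv_def by auto
  have "filterlim uminus (nhds 0) (nhds (0::real))"
    using tendsto_minus[OF filterlim_ident[of "nhds (0::real)"]] by simp
  then have ev: "\<forall>\<^sub>F t in nhds 0. (g has_real_derivative g' (- t)) (at (- t))"
    using g'(1) by (auto simp: filterlim_iff)
  have "((\<lambda>t. g (- t)) has_real_derivative - g' (- t)) (at t)"
    if "(g has_real_derivative g' (- t)) (at (- t))" for t
  proof -
    have "((\<lambda>t. g (- t)) has_real_derivative g' (- t) * (-1)) (at t)"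
      by (rule DERIV_chain2[where f = g and g = uminus, OF that]) (auto intro!: derivative_eq_intros)
    then show ?thesis by simp
  qed
  then have "\<forall>\<^sub>F t in nhds 0. ((\<lambda>t. g (- t)) has_real_derivative - g' (- t)) (at t)"
    using ev by (auto elim: eventually_mono)
  moreover have "((\<lambda>t. - g' (- t)) has_real_derivative d) (at 0)"
  proof -
    have "((\<lambda>t. g' (- t)) has_real_derivative d * (-1)) (at 0)"
      by (rule DERIV_chain2[of g' d uminus 0]) (use g'(2) in \<open>auto intro!: derivative_eq_intros\<close>)
    from DERIV_minus[OF this] show ?thesis by simp
  qed
  ultimately show ?thesis unfolding has_second_deriv_def
    by (intro exI[of _ "\<lambda>t. - g' (- t)"]) simp
qed

lemma has_second_deriv_local_min:
  assumes "has_second_deriv g d" and min: "\<forall>\<^sub>F t in nhds 0. g 0 \<le> g t"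
  shows "0 \<le> d"
proof (rule ccontr)
  assume "\<not> 0 \<le> d"
  then have d: "d < 0" by simp
  obtain g' where g':
    "\<forall>\<^sub>F t in nhds 0. (g has_real_derivative g' t) (at t)" "(g' has_real_derivative d) (at 0)"
    using assms unfolding has_second_deriv_def by auto
  obtain r where r: "r > 0" "\<And>t. \<bar>t\<bar> < r \<Longrightarrow> (g has_real_derivative g' t) (at t) \<and> g 0 \<le> g t"
    using eventually_conj[OF g'(1) min] unfolding eventually_nhds_metric
    by (auto simp: dist_real_def)
  have "g' 0 = 0"
    by (rule DERIV_local_min[of g "g' 0" 0 r]) (use r in auto)
  then obtain e where e: "e > 0" "\<And>h. 0 < h \<Longrightarrow> h < e \<Longrightarrow> g' h < 0"
    using DERIV_neg_dec_right[OF g'(2) d] by auto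
  define b where "b = min r e / 2"
  have b: "0 < b" "b < r" "b < e" using r(1) e(1) by (auto simp: b_def)
  obtain z where z: "0 < z" "z < b" "g b - g 0 = (b - 0) * g' z"
    using MVT2[of 0 b g g'] b r(2) by auto
  have "g b - g 0 < 0" using z b e(2)[of z] by (simp add: mult_pos_neg)
  then show False using r(2)[of b] b by auto
qed

lemma has_laplacian_add:
  assumes "has_laplacian v x l" "has_laplacian w x l'"
  shows "has_laplacian (\<lambda>y. v y + w y) x (l + l')"
proof -
  obtain d e where "\<forall>i. has_second_deriv (\<lambda>t. v (x + t *\<^sub>R axis i 1)) (d i)" "l = (\<Sum>i\<in>UNIV. d i)"
    "\<forall>i. has_second_deriv (\<lambda>t. w (x + t *\<^sub>R axis i 1)) (e i)" "l' = (\<Sum>i\<in>UNIV. e i)"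
    using assms unfolding has_laplacian_def by auto
  then show ?thesis unfolding has_laplacian_def
    by (intro exI[of _ "\<lambda>i. d i + e i"]) (auto simp: sum.distrib intro: has_second_deriv_add)
qed

lemma has_laplacian_cmult:
  assumes "has_laplacian v x l"
  shows "has_laplacian (\<lambda>y. c * v y) x (c * l)"
proof -
  obtain d where "\<forall>i. has_second_deriv (\<lambda>t. v (x + t *\<^sub>R axis i 1)) (d i)" "l = (\<Sum>i\<in>UNIV. d i)"
    using assms unfolding has_laplacian_def by auto
  then show ?thesis unfolding has_laplacian_def
    by (intro exI[of _ "\<lambda>i. c * d i"]) (auto simp: sum_distrib_left intro: has_second_deriv_cmult)
qed

lemma has_laplacian_diff:
  assumes "has_laplacian v x l" "has_laplacian w x l'"
  shows "has_laplacian (\<lambda>y. v y - w y) x (l - l')"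
  using has_laplacian_add[OF assms(1) has_laplacian_cmult[OF assms(2), of "-1"]] by simp

lemma has_second_deriv_const: "has_second_deriv (\<lambda>t. c) 0"
  unfolding has_second_deriv_def by (intro exI[of _ "\<lambda>t. 0"]) auto

lemma has_laplacian_const: "has_laplacian (\<lambda>y. c) x 0"
  unfolding has_laplacian_def by (intro exI[of _ "\<lambda>i. 0"]) (auto intro: has_second_deriv_const)

lemma has_laplacian_sum:
  assumes "finite C" "\<And>c. c \<in> C \<Longrightarrow> has_laplacian (v c) x (l c)"
  shows "has_laplacian (\<lambda>y. \<Sum>c\<in>C. v c y) x (\<Sum>c\<in>C. l c)"
  using assms by (induction C rule: finite_induct) (auto intro: has_laplacian_add has_laplacian_const)

lemma filterlim_along_axis:
  fixes x :: "real ^ 'n::finite"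
  shows "filterlim (\<lambda>t. x + t *\<^sub>R axis i 1) (nhds x) (nhds 0)"
proof -
  have "((\<lambda>t. x + t *\<^sub>R axis i 1) \<longlongrightarrow> x + 0 *\<^sub>R axis i 1) (nhds 0)"
    by (intro tendsto_intros filterlim_ident)
  then show ?thesis by simp
qed

lemma has_laplacian_local_min:
  assumes "has_laplacian v x l" "\<forall>\<^sub>F y in nhds x. v x \<le> v y"
  shows "0 \<le> l"
proof -
  obtain d where d: "\<forall>i. has_second_deriv (\<lambda>t. v (x + t *\<^sub>R axis i 1)) (d i)" "l = (\<Sum>i\<in>UNIV. d i)"
    using assms unfolding has_laplacian_def by auto
  have "0 \<le> d i" for i
  proof -
    have "\<forall>\<^sub>F t in nhds 0. v x \<le> v (x + t *\<^sub>R axis i 1)"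
      using filterlim_along_axis assms(2) by (auto simp: filterlim_iff)
    then show ?thesis
      using has_second_deriv_local_min[OF d(1)[rule_format, of i]] by simp
  qed
  then show ?thesis using d(2) by (simp add: sum_nonneg)
qed

text \<open>Along the \<open>i\<close>-th axis the squared distance is the quadratic \<open>\<rho> + 2 z\<^sub>i t + t\<^sup>2\<close> with
  \<open>z = x - c\<close>, so the second derivative is \<open>4 z\<^sub>i\<^sup>2 \<phi>'' + 2 \<phi>'\<close>; summation over \<open>i\<close> turns
  \<open>z\<^sub>i\<^sup>2\<close> into \<open>\<rho>\<close>. Every barrier below is of this form.\<close>
lemma has_laplacian_radial:
  fixes x c :: "real ^ 'n::finite"
  assumes "\<forall>\<^sub>F s in nhds ((norm (x - c))\<^sup>2). (\<phi> has_real_derivative \<phi>' s) (at s)"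
    and "(\<phi>' has_real_derivative b) (at ((norm (x - c))\<^sup>2))"
  shows "has_laplacian (\<lambda>y. \<phi> ((norm (y - c))\<^sup>2)) x
           (4 * b * (norm (x - c))\<^sup>2 + 2 * real CARD('n) * \<phi>' ((norm (x - c))\<^sup>2))"
proof -
  define z where "z = x - c"
  define \<rho> where "\<rho> = (norm z)\<^sup>2"
  have nsq: "(norm (x + t *\<^sub>R axis i 1 - c))\<^sup>2 = \<rho> + 2 * z $ i * t + t\<^sup>2" for i t
  proof -
    have "x + t *\<^sub>R axis i 1 - c = z + t *\<^sub>R axis i 1" by (simp add: z_def)
    then have "(norm (x + t *\<^sub>R axis i 1 - c))\<^sup>2 = (z + t *\<^sub>R axis i 1) \<bullet> (z + t *\<^sub>R axis i 1)"
      by (simp only: power2_norm_eq_inner)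
    also have "\<dots> = z \<bullet> z + 2 * z $ i * t + t * t"
      by (simp add: inner_add inner_axis inner_axis' algebra_simps)
    finally show ?thesis by (simp add: \<rho>_def power2_norm_eq_inner power2_eq_square[of t])
  qed
  have "has_second_deriv (\<lambda>t. \<phi> ((norm (x + t *\<^sub>R axis i 1 - c))\<^sup>2))
          (b * (2 * z $ i) * (2 * z $ i) + 2 * \<phi>' \<rho>)" for i
  proof -
    let ?q = "\<lambda>t. \<rho> + 2 * z $ i * t + t\<^sup>2"
    have "(?q \<longlongrightarrow> ?q 0) (nhds 0)" by (intro tendsto_intros filterlim_ident)
    then have ql: "filterlim ?q (nhds \<rho>) (nhds 0)" by simp
    have dq: "(?q has_real_derivative 2 * z $ i + 2 * t) (at t)" for t
      by (auto intro!: derivative_eq_intros)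
    have "\<forall>\<^sub>F t in nhds 0. (\<phi> has_real_derivative \<phi>' (?q t)) (at (?q t))"
      using assms(1) ql by (auto simp: filterlim_iff z_def \<rho>_def)
    then have 1: "\<forall>\<^sub>F t in nhds 0. ((\<lambda>t. \<phi> (?q t)) has_real_derivative \<phi>' (?q t) * (2 * z $ i + 2 * t)) (at t)"
      by eventually_elim (rule DERIV_chain2[OF _ dq])
    have "((\<lambda>t. \<phi>' (?q t)) has_real_derivative b * (2 * z $ i)) (at 0)"
      by (rule DERIV_chain2[of \<phi>' b ?q]) (use assms(2) dq[of 0] in \<open>auto simp: z_def \<rho>_def\<close>)
    then have 2: "((\<lambda>t. \<phi>' (?q t) * (2 * z $ i + 2 * t)) has_real_derivative
        b * (2 * z $ i) * (2 * z $ i) + 2 * \<phi>' \<rho>) (at 0)"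
      by (auto intro!: derivative_eq_intros)
    from 1 2 show ?thesis unfolding has_second_deriv_def nsq
      by (intro exI[of _ "\<lambda>t. \<phi>' (?q t) * (2 * z $ i + 2 * t)"] conjI)
  qed
  moreover have "(\<Sum>i\<in>UNIV. b * (2 * z $ i) * (2 * z $ i) + 2 * \<phi>' \<rho>)
      = 4 * b * \<rho> + 2 * real CARD('n) * \<phi>' \<rho>"
  proof -
    have "\<rho> = (\<Sum>i\<in>UNIV. z $ i * z $ i)"
      by (simp add: \<rho>_def power2_norm_eq_inner inner_vec_def)
    then show ?thesis by (simp add: sum.distrib sum_distrib_left algebra_simps)
  qed
  ultimately show ?thesis unfolding has_laplacian_def
    by (intro exI[of _ "\<lambda>i. b * (2 * z $ i) * (2 * z $ i) + 2 * \<phi>' \<rho>"]) (auto simp: z_def \<rho>_def)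
qed

lemma has_laplacian_gaussian:
  fixes x c :: "real ^ 'n::finite"
  shows "has_laplacian (\<lambda>y. exp (- a * (norm (y - c))\<^sup>2)) x
    ((4 * a\<^sup>2 * (norm (x - c))\<^sup>2 - 2 * real CARD('n) * a) * exp (- a * (norm (x - c))\<^sup>2))"
proof -
  have *: "has_laplacian (\<lambda>y. exp (- a * (norm (y - c))\<^sup>2)) x
    (4 * (a\<^sup>2 * exp (- a * (norm (x - c))\<^sup>2)) * (norm (x - c))\<^sup>2 +
      2 * real CARD('n) * (- a * exp (- a * (norm (x - c))\<^sup>2)))"
    by (rule has_laplacian_radial[where \<phi> = "\<lambda>s. exp (- a * s)" and \<phi>' = "\<lambda>s. - a * exp (- a * s)"])
      (auto intro!: derivative_eq_intros always_eventually simp: power2_eq_square)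
  show ?thesis using * by (simp add: algebra_simps)
qed

text \<open>In dimension at least two this is superharmonic and infinite at \<open>c\<close>. In contrast to the
  fundamental solution it needs no case distinction on the dimension.\<close>
lemma has_laplacian_log:
  fixes x c :: "real ^ 'n::finite"
  assumes "x \<noteq> c"
  shows "has_laplacian (\<lambda>y. - ln (norm (y - c))) x ((2 - real CARD('n)) / (norm (x - c))\<^sup>2)"
proof -
  have pos: "0 < (norm (x - c))\<^sup>2" using assms by simp
  have ev: "\<forall>\<^sub>F s in nhds ((norm (x - c))\<^sup>2). 0 < s"
    using pos by (auto intro: eventually_nhds_in_open[of "{0<..}", simplified])
  have "has_laplacian (\<lambda>y. - (1/2) * ln ((norm (y - c))\<^sup>2)) x
    (4 * (1 / (2 * ((norm (x - c))\<^sup>2)\<^sup>2)) * (norm (x - c))\<^sup>2 +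
      2 * real CARD('n) * (- 1 / (2 * (norm (x - c))\<^sup>2)))"
  proof (rule has_laplacian_radial[where \<phi> = "\<lambda>s. - (1/2) * ln s" and \<phi>' = "\<lambda>s. - 1 / (2 * s)"])
    show "\<forall>\<^sub>F s in nhds ((norm (x - c))\<^sup>2). ((\<lambda>s. - (1/2) * ln s) has_real_derivative - 1 / (2 * s)) (at s)"
      using ev by eventually_elim (auto intro!: derivative_eq_intros simp: field_simps)
    show "((\<lambda>s. - 1 / (2 * s)) has_real_derivative 1 / (2 * ((norm (x - c))\<^sup>2)\<^sup>2)) (at ((norm (x - c))\<^sup>2))"
      using pos by (auto intro!: derivative_eq_intros simp: field_simps power2_eq_square)
  qed
  moreover have "4 * (1 / (2 * ((norm (x - c))\<^sup>2)\<^sup>2)) * (norm (x - c))\<^sup>2 +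
      2 * real CARD('n) * (- 1 / (2 * (norm (x - c))\<^sup>2)) = (2 - real CARD('n)) / (norm (x - c))\<^sup>2"
    using pos by (simp add: field_simps power2_eq_square)
  moreover have "- (1/2) * ln ((norm (y - c))\<^sup>2) = - ln (norm (y - c))" for y
    by (cases "y = c") (auto simp: ln_realpow)
  ultimately show ?thesis by simp
qed

section \<open>A maximum principle for sets of small volume\<close>

text \<open>The Gaussian solution of the heat equation without its normalizing factor, so that its total
  mass is \<open>(4 \<pi>)^(n/2)\<close>.\<close>
definition heat_kernel :: "real \<Rightarrow> real ^ 'n::finite \<Rightarrow> real ^ 'n \<Rightarrow> real" where
  "heat_kernel t c x = t powr (- real CARD('n) / 2) * exp (- (1 / (4 * t)) * (norm (x - c))\<^sup>2)"

lemma has_laplacian_heat_kernel: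
  fixes x c :: "real ^ 'n::finite"
  assumes "0 < t"
  shows "has_laplacian (heat_kernel t c) x
    (heat_kernel t c x * ((norm (x - c))\<^sup>2 / (4 * t\<^sup>2) - real CARD('n) / (2 * t)))"
proof -
  have "has_laplacian (heat_kernel t c) x (t powr (- real CARD('n) / 2) *
     ((4 * (1 / (4 * t))\<^sup>2 * (norm (x - c))\<^sup>2 - 2 * real CARD('n) * (1 / (4 * t)))
        * exp (- (1 / (4 * t)) * (norm (x - c))\<^sup>2)))"
    unfolding heat_kernel_def by (intro has_laplacian_cmult has_laplacian_gaussian)
  moreover have "4 * (1 / (4 * t))\<^sup>2 * (norm (x - c))\<^sup>2 - 2 * real CARD('n) * (1 / (4 * t))
      = (norm (x - c))\<^sup>2 / (4 * t\<^sup>2) - real CARD('n) / (2 * t)"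
    using assms by (simp add: field_simps power2_eq_square)
  ultimately show ?thesis by (simp only: heat_kernel_def mult_ac)
qed

lemma heat_kernel_time_derivative:
  fixes x c :: "real ^ 'n::finite"
  assumes "0 < t"
  shows "((\<lambda>t. heat_kernel t c x) has_real_derivative
    heat_kernel t c x * ((norm (x - c))\<^sup>2 / (4 * t\<^sup>2) - real CARD('n) / (2 * t))) (at t)"
proof -
  define \<rho> where "\<rho> = (norm (x - c))\<^sup>2"
  have 1: "((\<lambda>t. t powr (- real CARD('n) / 2)) has_real_derivative
      (- real CARD('n) / 2) * t powr (- real CARD('n) / 2 - 1)) (at t)"
    using assms by (rule has_real_derivative_powr)
  have 2: "((\<lambda>t. exp (- (1 / (4 * t)) * \<rho>)) has_real_derivative
      \<rho> / (4 * t\<^sup>2) * exp (- (1 / (4 * t)) * \<rho>)) (at t)"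
    using assms by (auto intro!: derivative_eq_intros simp: field_simps power2_eq_square)
  have 3: "t powr (- real CARD('n) / 2 - 1) = t powr (- real CARD('n) / 2) / t"
    using assms by (simp add: powr_diff)
  show ?thesis
    using DERIV_mult[OF 1 2] assms unfolding heat_kernel_def \<rho>_def[symmetric] 3
    by (simp add: algebra_simps)
qed

text \<open>Vitali's lemma with balls of equal radius \<open>s / 5\<close>: the small balls are disjoint and lie in
  \<open>N\<close>, which bounds their number by the volume of \<open>N\<close>, while the balls of radius \<open>s\<close> with the
  same centres cover \<open>K\<close>.\<close>
lemma compact_finite_ball_cover:
  fixes K :: "'a::euclidean_space set"
  assumes K: "compact K" "K \<subseteq> N" and N: "open N" "N \<in> lmeasurable" and s0: "0 < s0"
  obtains s C where "0 < s" "s \<le> s0" "finite C" "K \<subseteq> (\<Union>c\<in>C. ball c s)"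
    "real (card C) * s ^ DIM('a) * measure lebesgue (ball (0::'a) 1) \<le> 5 ^ DIM('a) * measure lebesgue N"
proof -
  obtain e where e: "e > 0" "(\<Union>x\<in>K. ball x e) \<subseteq> N"
    using compact_subset_open_imp_ball_epsilon_subset[OF K(1) N(1) K(2)] by blast
  define s where "s = min e s0"
  have s: "0 < s" "s \<le> s0" "s \<le> e" using e s0 by (auto simp: s_def)
  have "K \<subseteq> (\<Union>c\<in>K. ball c (s / 5))" using s by auto
  then obtain C where C: "countable C" "C \<subseteq> K"
    and dis: "pairwise (\<lambda>i j. disjnt (ball i (s / 5)) (ball j (s / 5))) C"
    and cov: "K \<subseteq> (\<Union>c\<in>C. ball c (5 * (s / 5)))"
    using Vitali_covering_lemma_balls[where S = K and K = K and a = "\<lambda>c. c" and r = "\<lambda>_. s / 5" and B = s] s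
    by auto
  obtain C' where C': "C' \<subseteq> C" "finite C'" "K \<subseteq> (\<Union>c\<in>C'. ball c s)"
    using compactE_image[OF K(1), of C "\<lambda>c. ball c s"] cov by auto
  have sub: "(\<Union>c\<in>C'. ball c (s / 5)) \<subseteq> N"
    using e(2) s C(2) C'(1) by (force simp: subset_iff)
  have "(\<Sum>c\<in>C'. measure lebesgue (ball c (s / 5))) = measure lebesgue (\<Union>c\<in>C'. ball c (s / 5))"
    by (rule measure_UNION'[symmetric])
      (use C' pairwise_subset[OF dis C'(1)] in auto)
  also have "\<dots> \<le> measure lebesgue N"
    using sub N C'(2) by (intro measure_mono_fmeasurable) auto
  finally have "real (card C') * ((s / 5) ^ DIM('a) * measure lebesgue (ball (0::'a) 1)) \<le> measure lebesgue N"
    using s by (simp add: content_ball_conv_unit_ball[of "s / 5"])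
  then have "real (card C') * s ^ DIM('a) * measure lebesgue (ball (0::'a) 1) \<le> 5 ^ DIM('a) * measure lebesgue N"
    by (simp add: power_divide field_simps)
  with that s C' show ?thesis by blast
qed

text \<open>The factor \<open>exp (1/4)\<close> undoes the decay of \<open>heat_kernel (s\<^sup>2) c\<close> over the ball of radius \<open>s\<close>;
  the rest is the quotient of \<open>s ^ n\<close> by the volume of a ball of radius \<open>s / 5\<close>.\<close>
definition heat_const :: "'n::finite itself \<Rightarrow> real" where
  "heat_const _ = exp (1/4) * 5 ^ CARD('n) / measure lebesgue (ball (0::real ^ 'n) 1)"

lemma heat_const_pos: "0 < heat_const TYPE('n::finite)"
  by (simp add: heat_const_def content_ball_pos)

text \<open>Cover the superlevel set \<open>K\<close> by balls of a small radius \<open>s\<close> as above and let a Gaussian of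
  age \<open>s\<^sup>2\<close> sit at each centre, scaled so that the sum \<open>H\<close> is at least \<open>M\<close> on \<open>K\<close> at time \<open>s\<^sup>2\<close>.
  The function \<open>h - \<delta> - H - B t\<close> is then nonpositive initially and on the boundary of \<open>K\<close>. At a
  positive space-time maximum one would have \<open>- A \<le> \<Delta> h \<le> \<Delta> H = \<partial>\<^sub>t H \<le> - B\<close>, contrary to
  \<open>A < B\<close>. The mass of \<open>H\<close> is proportional to the volume of \<open>N\<close>, and this controls \<open>H\<close> at time
  \<open>T\<close>. Finite sums of Gaussians avoid any convolution integral.\<close>
lemma subsolution_bound:
  fixes h :: "real ^ 'n::finite \<Rightarrow> real"
  assumes N: "open N" "N \<in> lmeasurable"
    and K: "compact K" "K = {x \<in> N. \<delta> \<le> h x}" and \<delta>: "0 \<le> \<delta>"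
    and cont: "continuous_on N h"
    and M: "0 \<le> M" "\<And>x. x \<in> N \<Longrightarrow> h x \<le> M"
    and lap: "\<And>x. x \<in> N \<Longrightarrow> \<exists>l. - A \<le> l \<and> has_laplacian h x l"
    and B: "A < B" "0 \<le> B" and T: "0 < T" and x: "x \<in> K"
  shows "h x \<le> \<delta> + heat_const TYPE('n) * M * measure lebesgue N * T powr (- real CARD('n) / 2) + B * T"
proof (rule ccontr)
  assume neg: "\<not> ?thesis"
  obtain s C where s: "0 < s" "s \<le> sqrt T" and C: "finite C" "K \<subseteq> (\<Union>c\<in>C. ball c s)"
    "real (card C) * s ^ CARD('n) * measure lebesgue (ball (0::real ^ 'n) 1) \<le> 5 ^ CARD('n) * measure lebesgue N"
    using compact_finite_ball_cover[of K N "sqrt T"] K N T by auto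
  have s2: "0 < s\<^sup>2" "s\<^sup>2 \<le> T"
    using s T by (auto intro: sqrt_ge_absD simp: real_le_rsqrt abs_le_square_iff)
  define k where "k = M * exp (1/4) * s ^ CARD('n)"
  have k: "0 \<le> k" using M s by (simp add: k_def)
  define H where "H t y = k * (\<Sum>c\<in>C. heat_kernel t c y)" for t y
  define H' where "H' t y = k * (\<Sum>c\<in>C. heat_kernel t c y *
      ((norm (y - c))\<^sup>2 / (4 * t\<^sup>2) - real CARD('n) / (2 * t)))" for t y
  have hk0: "0 \<le> heat_kernel t c y" for t and c y :: "real ^ 'n" by (simp add: heat_kernel_def)
  have H0: "0 \<le> H t y" for t y
    using k by (auto simp: H_def intro!: mult_nonneg_nonneg sum_nonneg hk0)
  have lapH: "has_laplacian (H t) y (H' t y)" if "0 < t" for t y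
    unfolding H_def[abs_def] H'_def
    using C(1) that by (intro has_laplacian_cmult has_laplacian_sum has_laplacian_heat_kernel) auto
  have derH: "((\<lambda>t. H t y) has_real_derivative H' t y) (at t)" if "0 < t" for t y
    unfolding H_def H'_def
    by (intro DERIV_cmult DERIV_sum heat_kernel_time_derivative that)
  \<comment> \<open>one term of the sum already exceeds M, the one whose centre is within distance s\<close>
  have init: "M \<le> H (s\<^sup>2) y" if "y \<in> K" for y
  proof -
    obtain c where c: "c \<in> C" "dist c y < s" using C(2) \<open>y \<in> K\<close> by auto
    have "(s\<^sup>2) powr (- real CARD('n) / 2) = s powr (- real CARD('n))"
      using s by (simp add: powr_powr flip: powr_numeral)
    also have "\<dots> = 1 / s ^ CARD('n)"
      using s by (simp add: powr_minus_divide powr_realpow)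
    finally have e1: "(s\<^sup>2) powr (- real CARD('n) / 2) = 1 / s ^ CARD('n)" .
    have "(norm (y - c))\<^sup>2 \<le> s\<^sup>2"
      using c(2) by (intro power_mono) (auto simp: dist_norm norm_minus_commute)
    then have "- (1/4) \<le> - (1 / (4 * s\<^sup>2)) * (norm (y - c))\<^sup>2"
      using s by (simp add: field_simps)
    then have "1 / s ^ CARD('n) * exp (- (1/4)) \<le> heat_kernel (s\<^sup>2) c y"
      unfolding heat_kernel_def e1 using s by (intro mult_left_mono) auto
    also have "\<dots> \<le> (\<Sum>c\<in>C. heat_kernel (s\<^sup>2) c y)"
      using c C(1) by (intro member_le_sum hk0) auto
    finally have "k * (1 / s ^ CARD('n) * exp (- (1/4))) \<le> H (s\<^sup>2) y"
      unfolding H_def using k by (intro mult_left_mono) auto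
    then show ?thesis using s by (simp add: k_def exp_minus field_simps)
  qed
  have final: "H T y \<le> heat_const TYPE('n) * M * measure lebesgue N * T powr (- real CARD('n) / 2)" for y
  proof -
    have "heat_kernel T c y \<le> T powr (- real CARD('n) / 2)" for c :: "real ^ 'n"
      using T by (simp add: heat_kernel_def mult_left_le)
    then have "(\<Sum>c\<in>C. heat_kernel T c y) \<le> real (card C) * T powr (- real CARD('n) / 2)"
      by (intro sum_bounded_above) auto
    then have "H T y \<le> k * (real (card C) * T powr (- real CARD('n) / 2))"
      unfolding H_def using k by (intro mult_left_mono) auto
    also have "\<dots> = M * exp (1/4) * T powr (- real CARD('n) / 2) * (real (card C) * s ^ CARD('n))"
      by (simp add: k_def)
    also have "\<dots> \<le> M * exp (1/4) * T powr (- real CARD('n) / 2) *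
        (5 ^ CARD('n) * measure lebesgue N / measure lebesgue (ball (0::real ^ 'n) 1))"
      using C(3) M content_ball_pos[of 1 "0::real^'n"] by (intro mult_left_mono) (auto simp: field_simps)
    finally show ?thesis by (simp add: heat_const_def mult_ac)
  qed
  define F where "F = (\<lambda>(t, y). h y - \<delta> - H t y - B * t)"
  have KN: "K \<subseteq> N" using K by auto
  have contF: "continuous_on ({s\<^sup>2..T} \<times> K) F"
    unfolding F_def H_def heat_kernel_def case_prod_beta
    by (intro continuous_intros continuous_on_compose2[OF continuous_on_subset[OF cont KN]])
      (use s2 in \<open>auto simp: not_le intro: less_le_trans\<close>)
  have "F (T, x) > 0" using neg final[of x] by (simp add: F_def)
  obtain t1 x1 where t1: "t1 \<in> {s\<^sup>2..T}" and x1: "x1 \<in> K"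
    and max: "\<And>t y. t \<in> {s\<^sup>2..T} \<Longrightarrow> y \<in> K \<Longrightarrow> F (t, y) \<le> F (t1, x1)"
  proof -
    have "compact ({s\<^sup>2..T} \<times> K)" "{s\<^sup>2..T} \<times> K \<noteq> {}"
      using K s2 x by (auto intro: compact_Times)
    then show ?thesis
      using continuous_attains_sup[OF _ _ contF] that by (metis (no_types, lifting) SigmaE SigmaI)
  qed
  have F1: "F (t1, x1) > 0" using max[of T x] x s2 \<open>F (T, x) > 0\<close> by auto
  have t1_pos: "0 < t1" using t1 s2(1) by (simp only: atLeastAtMost_iff) linarith
  have "t1 \<noteq> s\<^sup>2"
  proof
    assume "t1 = s\<^sup>2"
    moreover have "0 \<le> B * s\<^sup>2" using B by simp
    ultimately show False using F1 init[OF x1] M(2)[of x1] x1 KN \<delta> by (auto simp: F_def)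
  qed
  then have t1s: "s\<^sup>2 < t1" using t1 by auto
  have "\<delta> < h x1" using F1 H0[of t1 x1] mult_nonneg_nonneg[OF B(2) less_imp_le[OF t1_pos]]
    by (simp add: F_def)
  \<comment> \<open>the strict inequality makes x1 an interior point of K, as the test along lines requires\<close>
  have near: "\<forall>\<^sub>F y in nhds x1. y \<in> K"
  proof -
    have "x1 \<in> N" using x1 KN by auto
    have "isCont h x1" using cont N(1) \<open>x1 \<in> N\<close> by (simp add: continuous_on_eq_continuous_at)
    then have ev: "\<forall>\<^sub>F y in nhds x1. \<delta> < h y"
      unfolding isCont_def tendsto_at_iff_tendsto_nhds
      using \<open>\<delta> < h x1\<close> by (rule order_tendstoD(1))
    have "\<forall>\<^sub>F y in nhds x1. y \<in> N" using N(1) \<open>x1 \<in> N\<close> by (rule eventually_nhds_in_open)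
    with ev show ?thesis by eventually_elim (auto simp: K)
  qed
  obtain l where l: "- A \<le> l" "has_laplacian h x1 l" using lap x1 KN by blast
  have "has_laplacian (\<lambda>y. H t1 y - h y) x1 (H' t1 x1 - l)"
    using has_laplacian_diff[OF lapH[OF t1_pos] l(2)] .
  moreover have "\<forall>\<^sub>F y in nhds x1. H t1 x1 - h x1 \<le> H t1 y - h y"
    using near
  proof eventually_elim
    case (elim y)
    then show ?case using max[OF t1 elim] by (simp add: F_def)
  qed
  ultimately have "l \<le> H' t1 x1" using has_laplacian_local_min by fastforce
  moreover have "H' t1 x1 \<le> - B"
  proof (rule ccontr)
    assume "\<not> H' t1 x1 \<le> - B"
    then have pos: "0 < H' t1 x1 + B" by simp
    have "((\<lambda>t. H t x1 + B * t) has_real_derivative H' t1 x1 + B) (at t1)"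
      using derH[OF t1_pos] by (auto intro!: derivative_eq_intros)
    from DERIV_pos_inc_left[OF this pos] obtain d where
      d: "d > 0" "\<And>e. 0 < e \<Longrightarrow> e < d \<Longrightarrow> H (t1 - e) x1 + B * (t1 - e) < H t1 x1 + B * t1" by auto
    define e where "e = min d (t1 - s\<^sup>2) / 2"
    have e: "0 < e" "e < d" "e < t1 - s\<^sup>2" using d(1) t1s by (auto simp: e_def)
    have "F (t1 - e, x1) \<le> F (t1, x1)" using e t1 x1 by (intro max) auto
    then show False using d(2)[OF e(1,2)] by (simp add: F_def)
  qed
  ultimately show False using l(1) B(1) by simp
qed

text \<open>The subsolution to which the heat comparison applies is \<open>- (w + \<epsilon> G)\<close> with the superharmonic
  barrier \<open>G = ln R - ln |x - p|\<close>, which is positive in \<open>D\<close>. As \<open>w\<close> is bounded below,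
  \<open>w + \<epsilon> G\<close> is positive near \<open>p\<close>, so its sublevel sets of negative level stay away from \<open>p\<close> as well as from
  the frontier and are compact. At each fixed point \<open>\<epsilon> G\<close> can be made arbitrarily small.\<close>
lemma supersolution_lower_bound:
  fixes w :: "real ^ 'n::finite \<Rightarrow> real"
  assumes n: "CARD('n) \<ge> 2" and D: "open D" "bounded D"
    and cont: "continuous_on (D - {p}) w"
    and M: "0 \<le> M" "\<And>x. x \<in> D - {p} \<Longrightarrow> - M \<le> w x"
    and bd: "\<And>x e. x \<in> frontier D \<Longrightarrow> x \<noteq> p \<Longrightarrow> 0 < e \<Longrightarrow> \<forall>\<^sub>F y in at x within D - {p}. - e < w y"
    and lap: "\<And>x. x \<in> D - {p} \<Longrightarrow> w x < 0 \<Longrightarrow> \<exists>l\<le>A. has_laplacian w x l"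
    and B: "0 \<le> A" "A < B" and T: "0 < T" and x: "x \<in> D - {p}"
  shows "- (heat_const TYPE('n) * M * measure lebesgue {y \<in> D - {p}. w y < 0}
              * T powr (- real CARD('n) / 2) + B * T) \<le> w x"
proof -
  define N where "N = {y \<in> D - {p}. w y < 0}"
  define b where "b = heat_const TYPE('n) * M * measure lebesgue N * T powr (- real CARD('n) / 2) + B * T"
  have b0: "0 \<le> b" using M B T heat_const_pos[where 'n = 'n] by (simp add: b_def)
  have D': "open (D - {p})" using D by auto
  have N_open: "open N"
    unfolding N_def using continuous_open_preimage[OF cont D', of "{..<0}"]
    by (simp add: vimage_def Int_def)
  have N_meas: "N \<in> lmeasurable"
    using N_open D by (intro lmeasurable_open) (auto simp: N_def intro: bounded_subset)
  obtain R where R: "R > 0" "\<And>y. y \<in> D \<Longrightarrow> norm (y - p) < R"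
  proof -
    obtain r where "\<And>y. y \<in> D \<Longrightarrow> norm (y - p) \<le> r"
      using D(2) bounded_iff[of "(\<lambda>y. y - p) ` D"] bounded_translation_minus[of D p] by auto
    then show ?thesis using that[of "\<bar>r\<bar> + 1"] by fastforce
  qed
  define G where "G y = ln R - ln (norm (y - p))" for y
  have G: "0 < G y" if "y \<in> D - {p}" for y
    using that R by (auto simp: G_def)
  have lapG: "has_laplacian G y ((2 - real CARD('n)) / (norm (y - p))\<^sup>2)" if "y \<noteq> p" for y
    using has_laplacian_add[OF has_laplacian_const[of "ln R"] has_laplacian_log[OF that]]
    by (simp add: G_def[abs_def])
  have contG: "continuous_on (D - {p}) G"
    unfolding G_def[abs_def] by (intro continuous_intros) auto
  have "- w x \<le> b + e" if e: "0 < e" for e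
  proof -
    define \<epsilon> where "\<epsilon> = e / (2 * G x)"
    have \<epsilon>: "0 < \<epsilon>" "\<epsilon> * G x = e / 2" using e G[OF x] by (auto simp: \<epsilon>_def)
    define h where "h y = - (w y + \<epsilon> * G y)" for y
    have conth: "continuous_on (D - {p}) h"
      unfolding h_def[abs_def] by (intro continuous_intros cont contG)
    define K where "K = {y \<in> N. e / 2 \<le> h y}"
    have sep: False if "y \<in> closure K" "\<forall>\<^sub>F z in nhds y. z \<notin> K" for y
      using that unfolding closure_iff_nhds_not_empty eventually_nhds by blast
    have "closure K \<subseteq> K"
    proof
      fix y assume y: "y \<in> closure K"
      consider "y \<in> D - {p}" | "y = p" | "y \<notin> D" "y \<noteq> p" by auto
      then show "y \<in> K"
      proof cases
        case 1
        have "isCont h y" using conth D' 1 by (simp add: continuous_on_eq_continuous_at)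
        then have "e / 2 \<le> h y"
        proof (rule_tac ccontr)
          assume "isCont h y" "\<not> e / 2 \<le> h y"
          then have "\<forall>\<^sub>F z in nhds y. h z < e / 2"
            unfolding isCont_def tendsto_at_iff_tendsto_nhds
            by (intro order_tendstoD(2)[of h "h y"]) auto
          then have "\<forall>\<^sub>F z in nhds y. z \<notin> K" by eventually_elim (auto simp: K_def)
          with sep y show False by blast
        qed
        moreover from this have "w y < 0"
          using e \<epsilon> mult_pos_pos[OF \<epsilon>(1) G[OF 1]] by (simp add: h_def)
        ultimately show ?thesis using 1 by (auto simp: K_def N_def)
      next
        case 2
        \<comment> \<open>within this distance of p the barrier term is at least \<open>M + \<epsilon>\<close>\<close>
        define r where "r = R * exp (- M / \<epsilon> - 1)"
        have r: "0 < r" using R by (simp add: r_def)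
        have "z \<notin> K" if "dist z p < r" for z
        proof
          assume z: "z \<in> K"
          then have zD: "z \<in> D - {p}" by (auto simp: K_def N_def)
          have "ln (norm (z - p)) \<le> ln r"
            using that zD r by (subst ln_le_cancel_iff) (auto simp: dist_norm)
          then have "M / \<epsilon> + 1 \<le> G z" using R by (simp add: G_def r_def ln_mult)
          then have "\<epsilon> * (M / \<epsilon> + 1) \<le> \<epsilon> * G z" using \<epsilon> by (intro mult_left_mono) auto
          moreover have "\<epsilon> * (M / \<epsilon> + 1) = M + \<epsilon>" using \<epsilon>(1) by (simp add: distrib_left)
          ultimately have "M \<le> \<epsilon> * G z" using \<epsilon>(1) by simp
          then have "h z \<le> 0" using M(2)[OF zD] by (simp add: h_def)
          then show False using z e by (simp add: K_def)
        qed
        then have "\<forall>\<^sub>F z in nhds y. z \<notin> K" using 2 r by (auto simp: eventually_nhds_metric)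
        with sep y show ?thesis by blast
      next
        case 3
        have "closure K \<subseteq> closure D" by (intro closure_mono) (auto simp: K_def N_def)
        then have "y \<in> frontier D" using y 3 D by (auto simp: frontier_def interior_open)
        then have "\<forall>\<^sub>F z in at y within D - {p}. - (e / 2) < w z" using bd[of y "e / 2"] 3 e by auto
        then have "\<forall>\<^sub>F z in nhds y. z \<noteq> y \<longrightarrow> z \<in> D - {p} \<longrightarrow> - (e / 2) < w z"
          by (simp add: eventually_at_filter)
        then have "\<forall>\<^sub>F z in nhds y. z \<notin> K"
        proof eventually_elim
          case (elim z)
          show ?case
          proof
            assume z: "z \<in> K"
            then have zD: "z \<in> D - {p}" by (auto simp: K_def N_def)
            then have "- (e / 2) < w z" using elim 3 by auto
            then have "h z < e / 2" using mult_pos_pos[OF \<epsilon>(1) G[OF zD]] by (simp add: h_def)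
            then show False using z by (simp add: K_def)
          qed
        qed
        with sep y show ?thesis by blast
      qed
    qed
    then have "closed K" by (simp add: closure_subset_eq)
    moreover have "bounded K" using D by (auto simp: K_def N_def intro: bounded_subset)
    ultimately have K: "compact K" by (simp add: compact_eq_bounded_closed)
    have "- w x \<le> b + e" if "x \<in> K"
    proof -
      have "h x \<le> e / 2 + heat_const TYPE('n) * M * measure lebesgue N * T powr (- real CARD('n) / 2) + B * T"
      proof (rule subsolution_bound[OF N_open N_meas K K_def])
        show "continuous_on N h" using conth by (rule continuous_on_subset) (auto simp: N_def)
        show "h y \<le> M" if "y \<in> N" for y
        proof -
          have "y \<in> D - {p}" using that by (auto simp: N_def)
          then show ?thesis using M(2)[of y] mult_pos_pos[OF \<epsilon>(1) G[of y]] by (simp add: h_def)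
        qed
        show "\<exists>l\<ge>- A. has_laplacian h y l" if "y \<in> N" for y
        proof -
          have y: "y \<in> D - {p}" "w y < 0" using that by (auto simp: N_def)
          obtain l where l: "l \<le> A" "has_laplacian w y l" using lap[OF y] by blast
          have "has_laplacian h y ((- 1) * (l + \<epsilon> * ((2 - real CARD('n)) / (norm (y - p))\<^sup>2)))"
            using has_laplacian_cmult[OF has_laplacian_add[OF l(2) has_laplacian_cmult[OF lapG, of y \<epsilon>]], of "-1"] y
            by (simp add: h_def[abs_def])
          moreover have "\<epsilon> * ((2 - real CARD('n)) / (norm (y - p))\<^sup>2) \<le> 0"
            using n \<epsilon> by (intro mult_nonneg_nonpos divide_nonpos_nonneg) auto
          ultimately show ?thesis using l(1)
            by (intro exI[of _ "(- 1) * (l + \<epsilon> * ((2 - real CARD('n)) / (norm (y - p))\<^sup>2))"]) auto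
        qed
      qed (use e M B T that in auto)
      then show ?thesis using \<epsilon> by (simp add: h_def b_def)
    qed
    moreover have "- w x \<le> b + e" if "x \<notin> K"
    proof (cases "x \<in> N")
      case True
      then show ?thesis using that \<epsilon> b0 e by (auto simp: K_def h_def)
    next
      case False
      then show ?thesis using x b0 e by (auto simp: N_def)
    qed
    ultimately show ?thesis by blast
  qed
  then have "- w x \<le> b" by (rule field_le_epsilon)
  then show ?thesis by (simp add: b_def N_def)
qed

text \<open>The hypothesis improves a lower bound \<open>- M\<close> to \<open>- (M / 2 + b)\<close>; for the optimal \<open>M\<close> this
  forces \<open>M \<le> 2 b\<close>. This is how a bound with a small factor absorbs itself.\<close>
lemma lower_bound_by_halving:
  fixes w :: "'a \<Rightarrow> real"
  assumes bdd: "bdd_below (w ` X)" and b: "0 \<le> b"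
    and half: "\<And>M. 0 \<le> M \<Longrightarrow> (\<And>x. x \<in> X \<Longrightarrow> - M \<le> w x) \<Longrightarrow> (\<And>x. x \<in> X \<Longrightarrow> - (M / 2 + b) \<le> w x)"
    and x: "x \<in> X"
  shows "- (2 * b) \<le> w x"
proof -
  define M where "M = max 0 (- Inf (w ` X))"
  have le: "- M \<le> w y" if "y \<in> X" for y
    using cInf_lower[OF imageI[OF that] bdd] by (auto simp: M_def)
  have "- (M / 2 + b) \<le> Inf (w ` X)"
    using half[of M] le x by (intro cInf_greatest) (auto simp: M_def)
  then have "M \<le> 2 * b" using b by (auto simp: M_def max_def split: if_splits)
  then show ?thesis using le[OF x] by linarith
qed

text \<open>When the volume term of the heat comparison has a factor at most one half it is absorbed by
  the lower bound itself, and only the contribution of \<open>A\<close> remains. With \<open>A = 0\<close> this is the usual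
  minimum principle, in which the volume of the set is arbitrary.\<close>
lemma maximum_principle:
  fixes w :: "real ^ 'n::finite \<Rightarrow> real"
  assumes n: "CARD('n) \<ge> 2" and D: "open D" "bounded D"
    and cont: "continuous_on (D - {p}) w"
    and bdd: "bdd_below (w ` (D - {p}))"
    and bd: "\<And>x e. x \<in> frontier D \<Longrightarrow> x \<noteq> p \<Longrightarrow> 0 < e \<Longrightarrow> \<forall>\<^sub>F y in at x within D - {p}. - e < w y"
    and lap: "\<And>x. x \<in> D - {p} \<Longrightarrow> w x < 0 \<Longrightarrow> \<exists>l\<le>A. has_laplacian w x l"
    and A: "0 \<le> A" and T: "0 < T"
    and small: "heat_const TYPE('n) * measure lebesgue {y \<in> D - {p}. w y < 0}
                  * T powr (- real CARD('n) / 2) \<le> 1 / 2"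
    and x: "x \<in> D - {p}"
  shows "- (2 * A * T) \<le> w x"
proof -
  have "- w x \<le> 2 * A * T + e" if e: "0 < e" for e
  proof -
    define B where "B = A + e / (2 * T)"
    have B: "A < B" "0 \<le> B" "2 * (B * T) = 2 * A * T + e" 
      using e T A by (auto simp: B_def algebra_simps add_pos_pos)
    have "- (2 * (B * T)) \<le> w x"
    proof (rule lower_bound_by_halving[OF bdd _ _ x])
      show "0 \<le> B * T" using B T by simp
      fix M y assume M: "0 \<le> M" "\<And>y. y \<in> D - {p} \<Longrightarrow> - M \<le> w y" and y: "y \<in> D - {p}"
      have "heat_const TYPE('n) * M * measure lebesgue {y \<in> D - {p}. w y < 0} * T powr (- real CARD('n) / 2)
          = M * (heat_const TYPE('n) * measure lebesgue {y \<in> D - {p}. w y < 0} * T powr (- real CARD('n) / 2))"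
        by simp
      also have "\<dots> \<le> M * (1 / 2)" using small M(1) by (rule mult_left_mono)
      finally show "- (M / 2 + B * T) \<le> w y"
        using supersolution_lower_bound[OF n D cont M bd lap A B(1) T y] by simp
    qed
    then show ?thesis using B(3) by linarith
  qed
  then have "- w x \<le> 2 * A * T" by (rule field_le_epsilon)
  then show ?thesis by linarith
qed

lemma ex_time_for_volume:
  assumes "0 \<le> V"
  obtains T where "0 < T" "heat_const TYPE('n::finite) * V * T powr (- real CARD('n) / 2) \<le> 1 / 2"
proof
  \<comment> \<open>\<open>T = b powr (2 / n)\<close> solves \<open>T powr (- n / 2) = 1 / b\<close>\<close>
  define b where "b = 2 * heat_const TYPE('n) * V + 1"
  have hv: "0 \<le> heat_const TYPE('n) * V" using assms heat_const_pos[where 'n = 'n] by simp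
  have b: "1 \<le> b" unfolding b_def using hv by linarith
  then show "0 < b powr (2 / real CARD('n))" by simp
  have "(b powr (2 / real CARD('n))) powr (- real CARD('n) / 2) = b powr - 1"
    by (simp add: powr_powr)
  also have "\<dots> = 1 / b" using b by (simp add: powr_minus_divide)
  finally have e: "(b powr (2 / real CARD('n))) powr (- real CARD('n) / 2) = 1 / b" .
  show "heat_const TYPE('n) * V * (b powr (2 / real CARD('n))) powr (- real CARD('n) / 2) \<le> 1 / 2"
  proof -
    have "heat_const TYPE('n) * V \<le> (1 / 2) * b" by (simp add: b_def)
    then show ?thesis unfolding e using b by (simp add: divide_le_eq)
  qed
qed

lemma ex_volume_for_time:
  assumes "0 < T"
  obtains \<mu> where "0 < \<mu>"
    "\<And>V. V \<le> \<mu> \<Longrightarrow> heat_const TYPE('n::finite) * V * T powr (- real CARD('n) / 2) \<le> 1 / 2"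
proof
  define c where "c = heat_const TYPE('n) * T powr (- real CARD('n) / 2)"
  have c: "0 < c" using assms heat_const_pos[where 'n = 'n] by (simp add: c_def)
  then show "0 < 1 / (2 * c)" by simp
  show "heat_const TYPE('n) * V * T powr (- real CARD('n) / 2) \<le> 1 / 2" if "V \<le> 1 / (2 * c)" for V
  proof -
    have "c * V \<le> c * (1 / (2 * c))" using that c by (intro mult_left_mono) auto
    also have "\<dots> = 1 / 2" using c by simp
    finally show ?thesis by (simp add: c_def mult_ac)
  qed
qed

section \<open>The strong maximum principle\<close>

text \<open>In an annulus around \<open>y\<close> a decreasing Gaussian is subharmonic once it is steep enough. Scaled
  to lie below \<open>w\<close> on the inner sphere and shifted to vanish on the outer one, it lies below \<open>w\<close> in
  between, and it is positive at \<open>x0\<close>.\<close>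
lemma superharmonic_pos_near:
  fixes w :: "real ^ 'n::finite \<Rightarrow> real"
  assumes r: "0 < r" and cont: "continuous_on (ball x0 (3 * r)) w"
    and nonneg: "\<And>x. x \<in> ball x0 (3 * r) \<Longrightarrow> 0 \<le> w x"
    and lap: "\<And>x. x \<in> ball x0 (3 * r) \<Longrightarrow> \<exists>l\<le>0. has_laplacian w x l"
    and y: "y \<in> ball x0 r" "0 < w y"
  shows "0 < w x0"
proof -
  have yb: "y \<in> ball x0 (3 * r)" using y r by auto
  then have "isCont w y" using cont by (simp add: continuous_on_eq_continuous_at)
  then have "\<forall>\<^sub>F x in nhds y. w y / 2 < w x"
    unfolding isCont_def tendsto_at_iff_tendsto_nhds using y(2) by (intro order_tendstoD(1)) auto
  then obtain s' where s': "0 < s'" "\<And>x. dist x y < s' \<Longrightarrow> w y / 2 < w x"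
    by (auto simp: eventually_nhds_metric)
  define s where "s = min s' r / 2"
  have s: "0 < s" "s < s'" "s < r" using s' r by (auto simp: s_def)
  show ?thesis
  proof (cases "dist x0 y \<le> s")
    case True
    then show ?thesis using s'(2)[of x0] s y(2) by auto
  next
    case False
    define \<eta> where "\<eta> = w y / 2"
    have \<eta>: "0 < \<eta>" using y by (simp add: \<eta>_def)
    \<comment> \<open>the Gaussian is subharmonic where \<open>2 a |x - y|\<^sup>2 \<ge> n\<close>, in particular outside the ball of radius s\<close>
    define a where "a = real CARD('n) / s\<^sup>2"
    have a: "0 < a" using s by (simp add: a_def)
    define b where "b x = \<eta> * (exp (- a * (norm (x - y))\<^sup>2) - exp (- a * (2 * r)\<^sup>2))" for x
    define F where "F x = w x - b x" for x
    define An where "An = cball y (2 * r) - ball y s"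
    have AnB: "An \<subseteq> ball x0 (3 * r)"
    proof
      fix x assume "x \<in> An"
      then have "dist x0 x < r + 2 * r"
        using y(1) dist_triangle[of x0 x y] by (auto simp: An_def)
      then show "x \<in> ball x0 (3 * r)" by simp
    qed
    have "compact An" unfolding An_def by (intro compact_diff) auto
    moreover have x0: "x0 \<in> An" using False y(1) r by (auto simp: An_def dist_commute)
    moreover have "continuous_on An F"
      unfolding F_def b_def by (intro continuous_intros continuous_on_subset[OF cont AnB])
    ultimately obtain x1 where x1: "x1 \<in> An" "\<And>x. x \<in> An \<Longrightarrow> F x1 \<le> F x"
      using continuous_attains_inf[of An F] by blast
    have "0 \<le> F x1"
    proof (rule ccontr)
      assume "\<not> 0 \<le> F x1"
      then have neg: "F x1 < 0" by simp
      have "dist x1 y \<noteq> s"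
      proof
        assume ds: "dist x1 y = s"
        have "b x1 \<le> \<eta> * 1" unfolding b_def
        proof (rule mult_left_mono)
          have "exp (- a * (norm (x1 - y))\<^sup>2) \<le> 1" using a by simp
          then show "exp (- a * (norm (x1 - y))\<^sup>2) - exp (- a * (2 * r)\<^sup>2) \<le> 1"
            by (smt (verit) exp_gt_zero)
        qed (use \<eta> in auto)
        moreover have "\<eta> < w x1" using s'(2)[of x1] ds s by (simp add: \<eta>_def)
        ultimately show False using neg by (simp add: F_def)
      qed
      moreover have "dist x1 y \<noteq> 2 * r"
      proof
        assume "dist x1 y = 2 * r"
        then have "b x1 = 0" by (simp add: b_def dist_norm)
        then show False using neg nonneg[of x1] x1(1) AnB by (auto simp: F_def)
      qed
      ultimately have d: "s < dist x1 y" "dist x1 y < 2 * r"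
        using x1(1) by (auto simp: An_def dist_commute)
      have "open (ball y (2 * r) - cball y s)" by auto
      then have "\<forall>\<^sub>F x in nhds x1. x \<in> ball y (2 * r) - cball y s"
        using d by (intro eventually_nhds_in_open) (auto simp: dist_commute)
      then have "\<forall>\<^sub>F x in nhds x1. F x1 \<le> F x"
        by eventually_elim (auto intro!: x1(2) simp: An_def)
      moreover obtain l where l: "l \<le> 0" "has_laplacian w x1 l" using lap x1(1) AnB by blast
      define g where "g = (4 * a\<^sup>2 * (norm (x1 - y))\<^sup>2 - 2 * real CARD('n) * a) * exp (- a * (norm (x1 - y))\<^sup>2)"
      have "has_laplacian b x1 (\<eta> * (g - 0))"
        unfolding b_def[abs_def] g_def
        by (intro has_laplacian_cmult has_laplacian_diff has_laplacian_gaussian has_laplacian_const)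
      then have "has_laplacian F x1 (l - \<eta> * g)"
        unfolding F_def[abs_def] using has_laplacian_diff[OF l(2)] by simp
      ultimately have "0 \<le> l - \<eta> * g" using has_laplacian_local_min by blast
      moreover have "0 < g"
      proof -
        have "s\<^sup>2 \<le> (norm (x1 - y))\<^sup>2" using d s by (intro power_mono) (auto simp: dist_norm)
        then have "4 * a\<^sup>2 * s\<^sup>2 \<le> 4 * a\<^sup>2 * (norm (x1 - y))\<^sup>2" by (intro mult_left_mono) auto
        moreover have "4 * a\<^sup>2 * s\<^sup>2 = 4 * real CARD('n) * a"
          using s by (simp add: a_def power2_eq_square)
        moreover have "0 < real CARD('n) * a" using a by simp
        ultimately show ?thesis unfolding g_def by (intro mult_pos_pos) (linarith | simp)+
      qed
      ultimately show False using l(1) mult_pos_pos[OF \<eta> \<open>0 < g\<close>] by linarith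
    qed
    then have "b x0 \<le> w x0" using x1(2)[OF x0] by (simp add: F_def)
    moreover have "0 < b x0"
    proof -
      have "(norm (x0 - y))\<^sup>2 < (2 * r)\<^sup>2"
        using y(1) r by (intro power_strict_mono) (auto simp: dist_norm)
      then show ?thesis using \<eta> a by (simp add: b_def)
    qed
    ultimately show ?thesis by linarith
  qed
qed

section \<open>Reflection in a hyperplane\<close>

definition reflect_at :: "'n::finite \<Rightarrow> real \<Rightarrow> real ^ 'n \<Rightarrow> real ^ 'n" where
  "reflect_at k \<mu> x = (\<chi> i. if i = k then 2 * \<mu> - x $ i else x $ i)"

lemma reflect_at_nth [simp]: "reflect_at k \<mu> x $ i = (if i = k then 2 * \<mu> - x $ i else x $ i)"
  by (simp add: reflect_at_def)

lemma reflect_at_reflect_at [simp]: "reflect_at k \<mu> (reflect_at k \<mu> x) = x"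
  by (simp add: vec_eq_iff)

lemma reflect_eq_reflect_at: "reflect k = reflect_at k 0"
  by (rule ext) (simp add: reflect_def reflect_at_def vec_eq_iff)

lemma reflect_at_eq_plus: "reflect_at k \<mu> x = x + (2 * (\<mu> - x $ k)) *\<^sub>R axis k 1"
  by (simp add: vec_eq_iff axis_def)

lemma continuous_on_reflect_at [continuous_intros]:
  assumes "continuous_on S f" "continuous_on S g"
  shows "continuous_on S (\<lambda>x. reflect_at k (f x) (g x))"
  unfolding reflect_at_eq_plus by (intro continuous_intros assms)

lemma isCont_reflect_at: "isCont (reflect_at k \<mu>) x"
  using continuous_on_reflect_at[OF continuous_on_const continuous_on_id, of UNIV k \<mu>]
  by (simp add: continuous_on_eq_continuous_at)

lemma has_laplacian_reflect_at:
  assumes "has_laplacian v (reflect_at k \<mu> x) l"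
  shows "has_laplacian (\<lambda>y. v (reflect_at k \<mu> y)) x l"
proof -
  obtain d where d: "\<And>i. has_second_deriv (\<lambda>t. v (reflect_at k \<mu> x + t *\<^sub>R axis i 1)) (d i)"
    and l: "l = (\<Sum>i\<in>UNIV. d i)"
    using assms unfolding has_laplacian_def by auto
  have "has_second_deriv (\<lambda>t. v (reflect_at k \<mu> (x + t *\<^sub>R axis i 1))) (d i)" for i
  proof (cases "i = k")
    case True
    have "reflect_at k \<mu> (x + t *\<^sub>R axis i 1) = reflect_at k \<mu> x + (- t) *\<^sub>R axis i 1" for t
      using True by (auto simp: vec_eq_iff axis_def)
    then show ?thesis using has_second_deriv_flip[OF d[of i]] by simp
  next
    case False
    have "reflect_at k \<mu> (x + t *\<^sub>R axis i 1) = reflect_at k \<mu> x + t *\<^sub>R axis i 1" for t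
      using False by (auto simp: vec_eq_iff axis_def)
    then show ?thesis using d[of i] by simp
  qed
  with l show ?thesis unfolding has_laplacian_def by blast
qed

text \<open>The point \<open>y\<close> lies on the segment from \<open>x\<close> to its mirror image. This places in \<open>\<Omega>\<close> the
  reflection in \<open>x $ k = \<mu>\<close> of any point of \<open>\<Omega>\<close> beyond that hyperplane, for \<open>\<mu> \<ge> 0\<close>.\<close>
lemma convex_symmetric_slice:
  assumes conv: "convex_in_direction k \<Omega>" and sym: "symmetric_in_direction k \<Omega>"
    and x: "x \<in> \<Omega>" and y: "\<And>i. i \<noteq> k \<Longrightarrow> y $ i = x $ i" "\<bar>y $ k\<bar> \<le> \<bar>x $ k\<bar>"
  shows "y \<in> \<Omega>"
proof -
  define t where "t = (if x $ k = 0 then 0 else (1 - y $ k / x $ k) / 2)"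
  have t: "t \<in> {0..1}"
  proof (cases "x $ k = 0")
    case False
    define c where "c = y $ k / x $ k"
    have "\<bar>c\<bar> \<le> 1" using y(2) False by (simp add: c_def abs_divide)
    then show ?thesis using False by (auto simp: t_def c_def[symmetric])
  qed (simp add: t_def)
  have "reflect k x \<in> \<Omega>" using sym x by (simp add: symmetric_in_direction_def)
  then have "(1 - t) *\<^sub>R x + t *\<^sub>R reflect k x \<in> \<Omega>"
    using conv x t unfolding convex_in_direction_def by (auto simp: reflect_def)
  moreover have "(1 - t) *\<^sub>R x + t *\<^sub>R reflect k x = y"
  proof (subst vec_eq_iff, rule allI)
    fix i
    show "((1 - t) *\<^sub>R x + t *\<^sub>R reflect k x) $ i = y $ i"
    proof (cases "i = k")
      case True
      have "(1 - t) * x $ k - t * x $ k = y $ k"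
        using y(2) by (auto simp: t_def field_simps)
      then show ?thesis using True by (simp add: reflect_def)
    next
      case False
      then show ?thesis using y(1)[OF False] by (simp add: reflect_def algebra_simps)
    qed
  qed
  ultimately show ?thesis by simp
qed

section \<open>Comparison with the reflected solution\<close>

text \<open>The boundary value problem as a system of second order: \<open>U j\<close> stands for the \<open>j\<close>-th iterate of
  the negative Laplacian on \<open>u\<close>. In this form the hypotheses are stable under reflection, see
  \<open>mirrored\<close>.\<close>
locale navier_system =
  fixes k :: "'n::finite" and m :: nat and \<Omega> :: "(real ^ 'n) set" and f :: "real \<Rightarrow> real"
    and L :: real and U :: "nat \<Rightarrow> real ^ 'n \<Rightarrow> real"
  assumes dim: "CARD('n) \<ge> 2" and m_pos: "m \<ge> 1"
    and Omega: "open \<Omega>" "bounded \<Omega>" "0 \<in> \<Omega>"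
    and conv: "convex_in_direction k \<Omega>" and sym: "symmetric_in_direction k \<Omega>"
    and L_nonneg: "0 \<le> L" and lip: "\<And>a b. 0 \<le> a \<Longrightarrow> 0 \<le> b \<Longrightarrow> \<bar>f a - f b\<bar> \<le> L * \<bar>a - b\<bar>"
    and f_mono: "\<And>a b. 0 \<le> a \<Longrightarrow> a \<le> b \<Longrightarrow> f a \<le> f b" and f_0: "0 \<le> f 0"
    and U_cont: "\<And>j. j < m \<Longrightarrow> continuous_on (\<Omega> - {0}) (U j)"
    and U_lap: "\<And>j x. j < m \<Longrightarrow> x \<in> \<Omega> - {0} \<Longrightarrow> has_laplacian (U j) x (- U (Suc j) x)"
    and U_top: "\<And>x. x \<in> \<Omega> - {0} \<Longrightarrow> U m x = f (U 0 x)"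
    and U_pos: "\<And>x. x \<in> \<Omega> - {0} \<Longrightarrow> 0 < U 0 x"
    and U_frontier: "\<And>j x. j < m \<Longrightarrow> x \<in> frontier \<Omega> \<Longrightarrow> (U j \<longlongrightarrow> 0) (at x within \<Omega> - {0})"
    and U_below: "\<And>j. j < m \<Longrightarrow> bdd_below (U j ` (\<Omega> - {0}))"
begin

lemma U_isCont: "j < m \<Longrightarrow> x \<in> \<Omega> - {0} \<Longrightarrow> isCont (U j) x"
  using U_cont[of j] Omega(1) open_delete[of \<Omega> 0] by (simp add: continuous_on_eq_continuous_at)

text \<open>Since \<open>f (u) \<ge> f 0 \<ge> 0\<close>, the top function is superharmonic up to the boundary values zero, hence
  nonnegative, and so on down to \<open>U 0\<close>.\<close>
lemma U_nonneg:
  assumes "j \<le> m" "x \<in> \<Omega> - {0}"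
  shows "0 \<le> U j x"
  using assms
proof (induction j arbitrary: x rule: inc_induct)
  case base
  then show ?case using U_top[of x] U_pos[of x] f_mono[of 0 "U 0 x"] f_0 by simp
next
  case (step j)
  define V where "V = measure lebesgue {y \<in> \<Omega> - {0}. U j y < 0}"
  obtain T where T: "0 < T" "heat_const TYPE('n) * V * T powr (- real CARD('n) / 2) \<le> 1 / 2"
    using ex_time_for_volume[of V, where 'n = 'n] by (auto simp: V_def)
  have "- (2 * 0 * T) \<le> U j x"
  proof (rule maximum_principle[OF dim Omega(1,2) U_cont U_below _ _ _ T(1) _ step.prems])
    show "\<forall>\<^sub>F y in at x within \<Omega> - {0}. - e < U j y" if "x \<in> frontier \<Omega>" "0 < e" for x e
      using U_frontier[OF step.hyps(2) that(1)] that(2) by (intro order_tendstoD(1)) auto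
    show "\<exists>l\<le>0. has_laplacian (U j) x l" if "x \<in> \<Omega> - {0}" for x
      using U_lap[OF step.hyps(2) that] step.IH[OF that]
      by (intro exI[of _ "- U (Suc j) x"]) auto
  qed (use step.hyps T in \<open>auto simp: V_def\<close>)
  then show ?case by simp
qed

definition cap :: "real \<Rightarrow> (real ^ 'n) set" where
  "cap \<mu> = {x \<in> \<Omega>. \<mu> < x $ k} - {reflect_at k \<mu> 0}"

text \<open>Only values on \<open>cap \<mu>\<close> matter, where both \<open>x\<close> and its reflection avoid the singularity.\<close>
definition W :: "real \<Rightarrow> nat \<Rightarrow> real ^ 'n \<Rightarrow> real" where
  "W \<mu> j x = U j (reflect_at k \<mu> x) - U j x"

lemma open_halfspace_Omega: "open {x \<in> \<Omega>. \<mu> < x $ k}"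
proof -
  have "{x \<in> \<Omega>. \<mu> < x $ k} = \<Omega> \<inter> {x. x $ k > \<mu>}" by auto
  then show ?thesis using Omega(1) open_halfspace_component_gt_cart[of \<mu> k] by auto
qed

lemma open_cap: "open (cap \<mu>)"
  unfolding cap_def using open_halfspace_Omega by (rule open_delete)

lemma bounded_halfspace_Omega: "bounded {x \<in> \<Omega>. \<mu> < x $ k}"
  using Omega(2) by (rule bounded_subset) auto

lemma cap_cases:
  assumes "0 < \<mu>" "x \<in> cap \<mu>"
  shows "x \<in> \<Omega> - {0}" "reflect_at k \<mu> x \<in> \<Omega> - {0}"
proof -
  have x: "x \<in> \<Omega>" "\<mu> < x $ k" "x \<noteq> reflect_at k \<mu> 0" using assms by (auto simp: cap_def)
  show "x \<in> \<Omega> - {0}" using x assms(1) by auto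
  have "reflect_at k \<mu> x \<in> \<Omega>"
    by (rule convex_symmetric_slice[OF conv sym x(1)]) (use x assms(1) in auto)
  moreover have "reflect_at k \<mu> x \<noteq> 0" using x(3) reflect_at_reflect_at[of k \<mu> x] by metis
  ultimately show "reflect_at k \<mu> x \<in> \<Omega> - {0}" by simp
qed

lemma W_isCont:
  assumes "j < m" "0 < \<mu>" "x \<in> \<Omega> - {0}" "reflect_at k \<mu> x \<in> \<Omega> - {0}"
  shows "isCont (W \<mu> j) x"
  unfolding W_def[abs_def]
  by (intro continuous_intros isCont_o2[OF isCont_reflect_at] U_isCont assms)

lemma W_cont:
  assumes "j < m" "0 < \<mu>"
  shows "continuous_on (cap \<mu>) (W \<mu> j)"
  using W_isCont[OF assms] cap_cases[OF assms(2)] by (intro continuous_at_imp_continuous_on) auto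

lemma W_lap:
  assumes "j < m" "0 < \<mu>" "x \<in> cap \<mu>"
  shows "has_laplacian (W \<mu> j) x (- W \<mu> (Suc j) x)"
  using has_laplacian_diff[OF has_laplacian_reflect_at[OF U_lap[OF assms(1)]] U_lap[OF assms(1)]]
    cap_cases[OF assms(2,3)] unfolding W_def[abs_def] by simp

text \<open>Extended by zero outside \<open>\<Omega>\<close>, the function \<open>U j\<close> is continuous on the part of the closure
  of \<open>\<Omega>\<close> with \<open>x $ k \<ge> \<mu>\<close>, a compact set without the singularity.\<close>
lemma U_bounded_away:
  assumes j: "j < m" and \<mu>: "0 < \<mu>"
  obtains C where "\<And>x. x \<in> \<Omega> \<Longrightarrow> \<mu> \<le> x $ k \<Longrightarrow> U j x \<le> C"
proof -
  define S where "S = closure \<Omega> \<inter> {x. \<mu> \<le> x $ k}"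
  define g where "g x = (if x \<in> \<Omega> then U j x else 0)" for x
  have "closed {x :: real ^ 'n. \<mu> \<le> x $ k}"
    using closed_halfspace_component_ge_cart[of \<mu> k] by simp
  then have S: "compact S"
    using Omega(2) by (auto simp: S_def compact_eq_bounded_closed intro: bounded_subset[of "closure \<Omega>"])
  have "continuous (at x within S) g" if x: "x \<in> S" for x
  proof (cases "x \<in> \<Omega>")
    case True
    then have "x \<in> \<Omega> - {0}" using x \<mu> by (auto simp: S_def)
    then have "isCont (U j) x" by (rule U_isCont[OF j])
    moreover have "\<forall>\<^sub>F y in nhds x. g y = U j y"
      using eventually_nhds_in_open[OF Omega(1) True] by eventually_elim (simp add: g_def)
    ultimately have "isCont g x" by (simp add: isCont_cong)
    then show ?thesis by (rule continuous_at_imp_continuous_at_within)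
  next
    case False
    then have "x \<in> frontier \<Omega>" using x Omega(1) by (auto simp: S_def frontier_def interior_open)
    then have lim: "(U j \<longlongrightarrow> 0) (at x within \<Omega> - {0})" using U_frontier j by blast
    have "(g \<longlongrightarrow> 0) (at x within S)"
    proof (rule tendstoI)
      fix e :: real assume e: "0 < e"
      from tendstoD[OF lim e] show "\<forall>\<^sub>F y in at x within S. dist (g y) 0 < e"
        unfolding eventually_at_filter
        by eventually_elim (use \<mu> e in \<open>auto simp: g_def S_def\<close>)
    qed
    then show ?thesis using False by (simp add: continuous_within g_def)
  qed
  then have "continuous_on S g" by (simp add: continuous_on_eq_continuous_within)
  then have "bounded (g ` S)" using compact_continuous_image[OF _ S] compact_imp_bounded by blast
  then obtain C where C: "\<And>x. x \<in> S \<Longrightarrow> \<bar>g x\<bar> \<le> C" by (auto simp: bounded_iff)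
  show ?thesis
  proof
    fix x assume "x \<in> \<Omega>" "\<mu> \<le> x $ k"
    then have "\<bar>g x\<bar> \<le> C" using closure_subset[of \<Omega>] by (intro C) (auto simp: S_def)
    then show "U j x \<le> C" using \<open>x \<in> \<Omega>\<close> by (simp add: g_def)
  qed
qed

text \<open>On \<open>cap \<mu>\<close> the subtracted term is bounded, and the reflected one is nonnegative, even where it
  blows up.\<close>
lemma W_below:
  assumes "j < m" "0 < \<mu>"
  shows "bdd_below (W \<mu> j ` cap \<mu>)"
proof -
  obtain C where C: "\<And>x. x \<in> \<Omega> \<Longrightarrow> \<mu> \<le> x $ k \<Longrightarrow> U j x \<le> C"
    using U_bounded_away[OF assms] by blast
  have "- C \<le> W \<mu> j x" if "x \<in> cap \<mu>" for x
    using C[of x] U_nonneg[of j, OF _ cap_cases(2)[OF assms(2) that]] that assms(1)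
    by (auto simp: W_def cap_def)
  then show ?thesis by (rule bdd_belowI2)
qed

text \<open>On the hyperplane the difference vanishes. At the remaining frontier points \<open>U j\<close> tends to
  zero, and the reflected term, which need not have a limit there, is nonnegative.\<close>
lemma W_frontier:
  assumes j: "j < m" and \<mu>: "0 < \<mu>" and x: "x \<in> frontier {x \<in> \<Omega>. \<mu> < x $ k}" and e: "0 < e"
  shows "\<forall>\<^sub>F y in at x within cap \<mu>. - e < W \<mu> j y"
proof -
  have xc: "x \<in> closure {x \<in> \<Omega>. \<mu> < x $ k}" and xn: "\<not> (x \<in> \<Omega> \<and> \<mu> < x $ k)"
    using x open_halfspace_Omega[of \<mu>] by (auto simp: frontier_def interior_open)
  have "closure {x \<in> \<Omega>. \<mu> < x $ k} \<subseteq> {x. \<mu> \<le> x $ k}"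
    by (rule closure_minimal) (use closed_halfspace_component_ge_cart[of \<mu> k] in auto)
  then have xk: "\<mu> \<le> x $ k" using xc by auto
  show ?thesis
  proof (cases "x \<in> \<Omega>")
    case True
    then have "x $ k = \<mu>" using xn xk by auto
    then have fix_x: "reflect_at k \<mu> x = x" by (simp add: vec_eq_iff)
    have "x \<in> \<Omega> - {0}" using True xk \<mu> by auto
    then have "isCont (W \<mu> j) x" using W_isCont[OF j \<mu>] fix_x by simp
    then have "(W \<mu> j \<longlongrightarrow> 0) (at x)" by (simp add: isCont_def W_def fix_x)
    then have "(W \<mu> j \<longlongrightarrow> 0) (at x within cap \<mu>)" by (rule tendsto_within_subset) auto
    then show ?thesis using e by (intro order_tendstoD(1)) auto
  next
    case False
    have "x \<in> closure \<Omega>" using xc closure_mono[of "{x \<in> \<Omega>. \<mu> < x $ k}" \<Omega>] by auto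
    then have "x \<in> frontier \<Omega>" using False Omega(1) by (auto simp: frontier_def interior_open)
    then have "(U j \<longlongrightarrow> 0) (at x within \<Omega> - {0})" using U_frontier j by blast
    then have "(U j \<longlongrightarrow> 0) (at x within cap \<mu>)"
      by (rule tendsto_within_subset) (use cap_cases[OF \<mu>] in auto)
    then have "\<forall>\<^sub>F y in at x within cap \<mu>. U j y < e" using e by (intro order_tendstoD(2)) auto
    then show ?thesis unfolding eventually_at_filter
    proof eventually_elim
      case (elim y)
      then show ?case using U_nonneg[of j "reflect_at k \<mu> y"] cap_cases[OF \<mu>, of y] j
        by (auto simp: W_def)
    qed
  qed
qed

lemma W_maximum_principle:
  assumes j: "j < m" and \<mu>: "0 < \<mu>" and A: "0 \<le> A" and T: "0 < T"
    and nxt: "\<And>x. x \<in> cap \<mu> \<Longrightarrow> - A \<le> W \<mu> (Suc j) x"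
    and small: "heat_const TYPE('n) * measure lebesgue {y \<in> cap \<mu>. W \<mu> j y < 0}
                  * T powr (- real CARD('n) / 2) \<le> 1 / 2"
    and x: "x \<in> cap \<mu>"
  shows "- (2 * A * T) \<le> W \<mu> j x"
proof (rule maximum_principle[where D = "{x \<in> \<Omega>. \<mu> < x $ k}" and p = "reflect_at k \<mu> 0", folded cap_def,
        OF dim open_halfspace_Omega bounded_halfspace_Omega W_cont[OF j \<mu>] W_below[OF j \<mu>] _ _ A T small x])
  show "\<exists>l\<le>A. has_laplacian (W \<mu> j) x l" if "x \<in> cap \<mu>" for x
    using W_lap[OF j \<mu> that] nxt[OF that] by (intro exI[of _ "- W \<mu> (Suc j) x"]) auto
qed (use W_frontier[OF j \<mu>] in auto)

lemma measure_subset_Omega: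
  assumes "X \<subseteq> \<Omega>" "open X"
  shows "measure lebesgue X \<le> measure lebesgue \<Omega>"
  using assms Omega by (intro measure_mono_fmeasurable) (auto intro: lmeasurable_open)

lemma open_negative_set:
  assumes "j < m" "0 < \<mu>"
  shows "open {y \<in> cap \<mu>. W \<mu> j y < 0}"
  using continuous_open_preimage[OF W_cont[OF assms] open_cap, of "{..<0}"]
  by (simp add: vimage_def Int_def)

text \<open>The coupling of the system: the bound for \<open>W \<mu> 0\<close> passes through \<open>f\<close> to the right hand side
  of the last equation, and each application of the maximum principle carries it one equation
  down at the cost of a factor \<open>2 T\<close>. Here \<open>T\<close> is adapted to the volume of all of \<open>\<Omega>\<close>, as nothing
  is known about the negative sets of the intermediate functions.\<close>
lemma W_lower_bounds:
  assumes \<mu>: "0 < \<mu>" and M: "0 \<le> M" "\<And>x. x \<in> cap \<mu> \<Longrightarrow> - M \<le> W \<mu> 0 x"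
    and T: "0 < T" "heat_const TYPE('n) * measure lebesgue \<Omega> * T powr (- real CARD('n) / 2) \<le> 1 / 2"
    and i: "i < m" and x: "x \<in> cap \<mu>"
  shows "- ((2 * T) ^ i * (L * M)) \<le> W \<mu> (m - i) x"
  using i x
proof (induction i arbitrary: x)
  case 0
  note c = cap_cases[OF \<mu> 0(2)]
  let ?a = "U 0 (reflect_at k \<mu> x)" and ?b = "U 0 x"
  have pos: "0 < ?a" "0 < ?b" using U_pos c by auto
  have W: "W \<mu> m x = f ?a - f ?b" using U_top c by (simp add: W_def)
  have "- (L * M) \<le> f ?a - f ?b"
  proof (cases "?b \<le> ?a")
    case True
    then have "f ?b \<le> f ?a" using f_mono pos by simp
    then show ?thesis using mult_nonneg_nonneg[OF L_nonneg M(1)] by linarith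
  next
    case False
    have "\<bar>?a - ?b\<bar> \<le> M" using M(2)[OF 0(2)] False by (simp add: W_def)
    then have "L * \<bar>?a - ?b\<bar> \<le> L * M" using L_nonneg by (rule mult_left_mono)
    moreover have "\<bar>f ?a - f ?b\<bar> \<le> L * \<bar>?a - ?b\<bar>" using lip pos by simp
    ultimately show ?thesis by linarith
  qed
  then show ?case by (simp add: W)
next
  case (Suc i)
  define j where "j = m - Suc i"
  have j: "j < m" "Suc j = m - i" using Suc.prems by (auto simp: j_def)
  have "- (2 * ((2 * T) ^ i * (L * M)) * T) \<le> W \<mu> j x"
  proof (rule W_maximum_principle[OF j(1) \<mu> _ T(1) _ _ Suc.prems(2)])
    have "measure lebesgue {y \<in> cap \<mu>. W \<mu> j y < 0} \<le> measure lebesgue \<Omega>"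
      using open_negative_set[OF j(1) \<mu>] cap_cases[OF \<mu>] by (intro measure_subset_Omega) auto
    then have "heat_const TYPE('n) * measure lebesgue {y \<in> cap \<mu>. W \<mu> j y < 0} * T powr (- real CARD('n) / 2)
        \<le> heat_const TYPE('n) * measure lebesgue \<Omega> * T powr (- real CARD('n) / 2)"
      using heat_const_pos[where 'n = 'n] by (intro mult_right_mono mult_left_mono) auto
    then show "heat_const TYPE('n) * measure lebesgue {y \<in> cap \<mu>. W \<mu> j y < 0} * T powr (- real CARD('n) / 2) \<le> 1 / 2"
      using T(2) by linarith
    show "- ((2 * T) ^ i * (L * M)) \<le> W \<mu> (Suc j) x" if "x \<in> cap \<mu>" for x
      using Suc.IH[OF _ that] Suc.prems j by simp
  qed (use L_nonneg M T in auto)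
  then show ?case by (simp add: j_def mult_ac)
qed

lemma ex_volume_time: "\<exists>T>0. heat_const TYPE('n) * measure lebesgue \<Omega> * T powr (- real CARD('n) / 2) \<le> 1 / 2"
  using ex_time_for_volume[of "measure lebesgue \<Omega>", where 'n = 'n] by auto

text \<open>Going once round the system multiplies the bound \<open>M\<close> for \<open>W \<mu> 0\<close> by a fixed factor times the
  time \<open>T\<close> of the last step, and a small volume of \<open>{W \<mu> 0 < 0}\<close> allows this \<open>T\<close> to be so small that \<open>M\<close> is halved.\<close>
lemma small_negative_set:
  obtains \<nu> where "0 < \<nu>"
    "\<And>\<mu> x. 0 < \<mu> \<Longrightarrow> measure lebesgue {y \<in> cap \<mu>. W \<mu> 0 y < 0} \<le> \<nu> \<Longrightarrow> x \<in> cap \<mu> \<Longrightarrow> 0 \<le> W \<mu> 0 x"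
proof -
  obtain S where S: "0 < S" "heat_const TYPE('n) * measure lebesgue \<Omega> * S powr (- real CARD('n) / 2) \<le> 1 / 2"
    using ex_volume_time by blast
  define A where "A = (2 * S) ^ (m - 1) * L"
  have A: "0 \<le> A" using S L_nonneg by (simp add: A_def)
  \<comment> \<open>chosen such that \<open>2 A M T \<le> M / 2\<close>; the summand 1 covers \<open>A = 0\<close>\<close>
  define T where "T = 1 / (4 * (A + 1))"
  have T: "0 < T" "4 * (A * T) \<le> 1" using A by (auto simp: T_def field_simps)
  obtain \<nu> where \<nu>: "0 < \<nu>"
    "\<And>V. V \<le> \<nu> \<Longrightarrow> heat_const TYPE('n) * V * T powr (- real CARD('n) / 2) \<le> 1 / 2"
    using ex_volume_for_time[OF T(1), where 'n = 'n] by blast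
  show ?thesis
  proof (rule that[OF \<nu>(1)])
    fix \<mu> x
    assume \<mu>: "0 < \<mu>" and small: "measure lebesgue {y \<in> cap \<mu>. W \<mu> 0 y < 0} \<le> \<nu>" and x: "x \<in> cap \<mu>"
    have m0: "0 < m" using m_pos by simp
    have "- (2 * 0) \<le> W \<mu> 0 x"
    proof (rule lower_bound_by_halving[OF W_below[OF m0 \<mu>] _ _ x])
      fix M y assume M: "0 \<le> M" "\<And>y. y \<in> cap \<mu> \<Longrightarrow> - M \<le> W \<mu> 0 y" and y: "y \<in> cap \<mu>"
      have "- (2 * (A * M) * T) \<le> W \<mu> 0 y"
      proof (rule W_maximum_principle[OF m0 \<mu> _ T(1) _ \<nu>(2)[OF small] y])
        show "- (A * M) \<le> W \<mu> (Suc 0) z" if "z \<in> cap \<mu>" for z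
          using W_lower_bounds[OF \<mu> M S, of "m - 1" z] that m_pos by (simp add: A_def mult.assoc)
      qed (use A M in auto)
      moreover have "4 * (A * T) * M \<le> 1 * M" using T(2) M(1) by (rule mult_right_mono)
      ultimately show "- (M / 2 + 0) \<le> W \<mu> 0 y" by (simp add: mult_ac)
    qed simp
    then show "0 \<le> W \<mu> 0 x" by simp
  qed
qed

section \<open>Strict positivity\<close>

text \<open>The zero set is open by the strong maximum principle, so a zero can be moved off the \<open>k\<close>-th
  axis, using that there is another coordinate. On the ray in direction \<open>k\<close> from there to the first
  exit \<open>q\<close> from \<open>\<Omega>\<close> the difference stays zero, and neither singularity is met. At \<open>q\<close> this gives
  \<open>U 0\<close> the value zero at the reflection of \<open>q\<close>, which lies strictly between \<open>q\<close> and its mirror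
  image and hence in \<open>\<Omega>\<close>; there \<open>U 0\<close> is positive. Each component of a disconnected cap is reached in this way.\<close>
lemma W_positive:
  assumes \<mu>: "0 < \<mu>" and nonneg: "\<And>x. x \<in> cap \<mu> \<Longrightarrow> 0 \<le> W \<mu> 0 x" and z: "z \<in> cap \<mu>"
  shows "0 < W \<mu> 0 z"
proof (rule ccontr)
  assume "\<not> 0 < W \<mu> 0 z"
  then have Wz: "W \<mu> 0 z = 0" using nonneg[OF z] by simp
  have m0: "0 < m" using m_pos by simp
  obtain S where S: "0 < S" "heat_const TYPE('n) * measure lebesgue \<Omega> * S powr (- real CARD('n) / 2) \<le> 1 / 2"
    using ex_volume_time by blast
  have W1: "0 \<le> W \<mu> (Suc 0) x" if "x \<in> cap \<mu>" for x
    using W_lower_bounds[OF \<mu> _ _ S, of 0 "m - 1" x] nonneg that m_pos by simp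
  define Z where "Z = {x \<in> cap \<mu>. W \<mu> 0 x = 0}"
  define P where "P = {x \<in> cap \<mu>. 0 < W \<mu> 0 x}"
  have P: "open P"
    unfolding P_def using continuous_open_preimage[OF W_cont[OF m0 \<mu>] open_cap, of "{0<..}"]
    by (simp add: vimage_def Int_def)
  have Z: "open Z"
  proof (subst open_contains_ball, rule ballI)
    fix x assume x: "x \<in> Z"
    then obtain R where R: "0 < R" "ball x R \<subseteq> cap \<mu>"
      using open_cap[of \<mu>] unfolding open_contains_ball Z_def by blast
    define r where "r = R / 3"
    have r: "0 < r" "ball x (3 * r) \<subseteq> cap \<mu>" using R by (auto simp: r_def)
    have "y \<in> Z" if y: "y \<in> ball x r" for y
    proof (rule ccontr)
      assume "y \<notin> Z"
      have "y \<in> cap \<mu>" using y r by (auto simp: subset_iff)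
      then have "0 < W \<mu> 0 y" using \<open>y \<notin> Z\<close> nonneg[of y] by (auto simp: Z_def)
      then have "0 < W \<mu> 0 x"
        using r y
      proof (intro superharmonic_pos_near[of r x "W \<mu> 0" y])
        show "\<exists>l\<le>0. has_laplacian (W \<mu> 0) v l" if "v \<in> ball x (3 * r)" for v
          using W_lap[OF m0 \<mu>, of v] W1[of v] that r(2) by (intro exI[of _ "- W \<mu> (Suc 0) v"]) auto
      qed (use nonneg continuous_on_subset[OF W_cont[OF m0 \<mu>]] in auto)
      then show False using x by (simp add: Z_def)
    qed
    then show "\<exists>e>0. ball x e \<subseteq> Z" using r(1) by blast
  qed
  \<comment> \<open>leave the k-th axis, which contains 0 and the reflected singularity\<close>
  have "\<exists>i. i \<noteq> k"
  proof (rule ccontr)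
    assume "\<not> ?thesis"
    then have "(UNIV :: 'n set) = {k}" by auto
    then have "CARD('n) = card {k}" by metis
    then show False using dim by simp
  qed
  then obtain i where i: "i \<noteq> k" by blast
  obtain r where r: "0 < r" "ball z r \<subseteq> Z"
    using Z z Wz by (auto simp: Z_def open_contains_ball)
  define z' where "z' = (if z $ i \<noteq> 0 then z else z + (r / 2) *\<^sub>R axis i 1)"
  have z': "z' \<in> Z" "z' $ i \<noteq> 0"
  proof -
    have "z' \<in> ball z r" using r by (auto simp: z'_def dist_norm)
    then show "z' \<in> Z" using r by blast
    show "z' $ i \<noteq> 0" using r by (auto simp: z'_def)
  qed
  then have z'c: "z' \<in> \<Omega>" "\<mu> < z' $ k" by (auto simp: Z_def cap_def)
  \<comment> \<open>follow the ray from z' until it leaves the open set at time \<open>\<tau>\<close>\<close>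
  define \<gamma> where "\<gamma> t = z' + t *\<^sub>R axis k 1" for t :: real
  have \<gamma>k: "\<gamma> t $ k = z' $ k + t" for t by (simp add: \<gamma>_def)
  have \<gamma>o: "\<gamma> t $ j = z' $ j" if "j \<noteq> k" for t j using that by (simp add: \<gamma>_def axis_def)
  have \<gamma>_cont: "continuous_on A \<gamma>" for A unfolding \<gamma>_def by (intro continuous_intros)
  define X where "X = {t. 0 \<le> t \<and> \<gamma> t \<notin> \<Omega>}"
  have "X = {0..} \<inter> \<gamma> -` (- \<Omega>)" by (auto simp: X_def)
  moreover have "closed (\<gamma> -` (- \<Omega>))"
    by (intro closed_vimage \<gamma>_cont) (use Omega(1) in \<open>simp add: closed_open\<close>)
  ultimately have X_closed: "closed X" by auto
  obtain b where b: "\<And>x. x \<in> \<Omega> \<Longrightarrow> norm x \<le> b" using Omega(2) by (auto simp: bounded_iff)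
  have "\<bar>b\<bar> + 1 \<in> X"
  proof -
    have "\<bar>b\<bar> < \<gamma> (\<bar>b\<bar> + 1) $ k" using z'c \<mu> by (simp add: \<gamma>k)
    also have "\<dots> \<le> norm (\<gamma> (\<bar>b\<bar> + 1))" using component_le_norm_cart[of "\<gamma> (\<bar>b\<bar> + 1)" k] by linarith
    finally show ?thesis using b[of "\<gamma> (\<bar>b\<bar> + 1)"] by (force simp: X_def)
  qed
  then have X_ne: "X \<noteq> {}" by auto
  have X_bdd: "bdd_below X" by (rule bdd_belowI[of _ 0]) (auto simp: X_def)
  define \<tau> where "\<tau> = Inf X"
  have \<tau>X: "\<tau> \<in> X" unfolding \<tau>_def by (rule closed_contains_Inf[OF X_ne X_bdd X_closed])
  have before: "\<gamma> t \<in> \<Omega>" if "0 \<le> t" "t < \<tau>" for t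
    using cInf_lower[OF _ X_bdd, of t] that by (force simp: X_def \<tau>_def)
  have "\<tau> \<noteq> 0" using \<tau>X z'c by (auto simp: X_def \<gamma>_def)
  then have \<tau>: "0 < \<tau>" "\<gamma> \<tau> \<notin> \<Omega>" using \<tau>X by (auto simp: X_def)
  have in_cap: "\<gamma> t \<in> cap \<mu>" if "0 \<le> t" "t < \<tau>" for t
  proof -
    have "\<gamma> t \<noteq> reflect_at k \<mu> 0" using z'(2) \<gamma>o[OF i, of t] i by (auto simp: vec_eq_iff)
    then show ?thesis using before[OF that] z'c that by (auto simp: cap_def \<gamma>k)
  qed
  have zero: "W \<mu> 0 (\<gamma> t) = 0" if t: "0 \<le> t" "t < \<tau>" for t
  proof (rule ccontr)
    assume "W \<mu> 0 (\<gamma> t) \<noteq> 0"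
    then have "\<gamma> t \<in> P" using nonneg[OF in_cap[OF t]] in_cap[OF t] by (auto simp: P_def)
    moreover have "\<gamma> 0 \<in> Z" using z' by (simp add: \<gamma>_def)
    moreover have "connected (\<gamma> ` {0..<\<tau>})" by (intro connected_continuous_image \<gamma>_cont) simp
    moreover have "\<gamma> ` {0..<\<tau>} \<subseteq> Z \<union> P"
      using in_cap nonneg by (force simp: Z_def P_def)
    moreover have "Z \<inter> P \<inter> \<gamma> ` {0..<\<tau>} = {}" by (auto simp: Z_def P_def)
    ultimately show False
      using connectedD[of "\<gamma> ` {0..<\<tau>}" Z P] Z P t \<tau> by (auto simp: disjoint_iff)
  qed
  \<comment> \<open>along the ray \<open>U 0\<close> tends to 0, but its values at the reflected points tend to \<open>U 0 q' > 0\<close>\<close>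
  define q where "q = \<gamma> \<tau>"
  have at: "at_left \<tau> \<noteq> bot" by simp
  have \<gamma>_lim: "(\<gamma> \<longlongrightarrow> q) (at_left \<tau>)"
    unfolding q_def using \<gamma>_cont[of UNIV]
    by (auto simp: continuous_on_def intro: tendsto_within_subset)
  have ev: "\<forall>\<^sub>F t in at_left \<tau>. 0 < t \<and> t < \<tau>"
    using \<tau>(1) eventually_at_left_field by (auto intro!: exI[of _ 0])
  have "q \<in> closure \<Omega>"
    by (rule Lim_in_closed_set[OF closed_closure _ at \<gamma>_lim])
      (use ev in \<open>auto elim!: eventually_mono intro!: subsetD[OF closure_subset] before\<close>)
  then have q: "q \<in> frontier \<Omega>" using \<tau>(2) Omega(1) by (auto simp: frontier_def interior_open q_def)
  have "filterlim \<gamma> (at q within \<Omega> - {0}) (at_left \<tau>)"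
    unfolding filterlim_at
  proof
    show "\<forall>\<^sub>F t in at_left \<tau>. \<gamma> t \<in> \<Omega> - {0} \<and> \<gamma> t \<noteq> q"
      using ev
    proof eventually_elim
      case (elim t)
      then have "\<gamma> t \<in> \<Omega> - {0}" by (intro cap_cases(1)[OF \<mu>] in_cap) auto
      then show ?case using \<tau>(2) by (auto simp: q_def)
    qed
  qed (rule \<gamma>_lim)
  then have lim0: "((\<lambda>t. U 0 (\<gamma> t)) \<longlongrightarrow> 0) (at_left \<tau>)"
    using filterlim_compose[OF U_frontier[OF m0 q]] by blast
  define q' where "q' = reflect_at k \<mu> q"
  have q': "q' \<in> \<Omega> - {0}"
  proof -
    \<comment> \<open>late enough on the ray for the mirrored segment through \<open>\<gamma> t\<close> to reach q'\<close>
    define t where "t = max 0 (max (\<bar>2 * \<mu> - q $ k\<bar> - z' $ k) 0)"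
    have qk: "q $ k = z' $ k + \<tau>" by (simp add: q_def \<gamma>k)
    have t: "0 \<le> t" "t < \<tau>" "\<bar>q' $ k\<bar> \<le> \<bar>\<gamma> t $ k\<bar>"
      using \<tau>(1) z'c \<mu> by (auto simp: t_def qk \<gamma>k q'_def)
    have "q' \<in> \<Omega>"
      by (rule convex_symmetric_slice[OF conv sym before[OF t(1,2)] _ t(3)])
        (simp add: q'_def q_def \<gamma>o)
    moreover have "q' $ i \<noteq> 0" using z'(2) i \<gamma>o[OF i, of \<tau>] by (simp add: q'_def q_def)
    ultimately show ?thesis by auto
  qed
  have "((\<lambda>t. reflect_at k \<mu> (\<gamma> t)) \<longlongrightarrow> q') (at_left \<tau>)"
    unfolding q'_def by (rule isCont_tendsto_compose[OF isCont_reflect_at \<gamma>_lim])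
  then have "((\<lambda>t. U 0 (reflect_at k \<mu> (\<gamma> t))) \<longlongrightarrow> U 0 q') (at_left \<tau>)"
    by (rule isCont_tendsto_compose[OF U_isCont[OF m0 q']])
  then have "((\<lambda>t. U 0 (\<gamma> t)) \<longlongrightarrow> U 0 q') (at_left \<tau>)"
  proof (rule Lim_transform_eventually)
    show "\<forall>\<^sub>F t in at_left \<tau>. U 0 (reflect_at k \<mu> (\<gamma> t)) = U 0 (\<gamma> t)"
      using ev by eventually_elim (use zero in \<open>auto simp: W_def\<close>)
  qed
  then have "U 0 q' = 0" using tendsto_unique[OF at _ lim0] by simp
  then show False using U_pos[OF q'] by simp
qed

section \<open>Moving the plane\<close>

lemma cap_iff: "x \<in> cap \<mu> \<longleftrightarrow> x \<in> \<Omega> \<and> \<mu> < x $ k \<and> reflect_at k \<mu> x \<noteq> 0"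
  unfolding cap_def using reflect_at_reflect_at[of k \<mu>] by (metis (no_types, lifting) DiffE DiffI mem_Collect_eq singleton_iff)

lemma thin_slab:
  assumes e: "0 < e"
  obtains \<eta> where "0 < \<eta>" "{x \<in> \<Omega>. \<mu> - \<eta> < x $ k \<and> x $ k \<le> \<mu>} \<in> lmeasurable"
    "measure lebesgue {x \<in> \<Omega>. \<mu> - \<eta> < x $ k \<and> x $ k \<le> \<mu>} < e"
proof -
  define A where "A n = {x \<in> \<Omega>. \<mu> - 1 / real (Suc n) < x $ k \<and> x $ k \<le> \<mu>}" for n
  have meas: "A n \<in> lmeasurable" for n
  proof -
    have "A n = {x \<in> \<Omega>. \<mu> - 1 / real (Suc n) < x $ k} - {x. x $ k > \<mu>}" by (auto simp: A_def)
    moreover have "{x \<in> \<Omega>. \<mu> - 1 / real (Suc n) < x $ k} \<in> lmeasurable"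
      using open_halfspace_Omega bounded_halfspace_Omega by (rule_tac lmeasurable_open) auto
    moreover have "{x :: real ^ 'n. x $ k > \<mu>} \<in> sets lebesgue"
      using open_halfspace_component_gt_cart[of \<mu> k] by (intro sets_completionI_sets) auto
    ultimately show ?thesis by (simp add: fmeasurable.Diff fmeasurable_Diff)
  qed
  have "(\<lambda>n. measure lebesgue (A n)) \<longlonglongrightarrow> measure lebesgue (\<Inter>n. A n)"
  proof (rule Lim_measure_decseq)
    show "range A \<subseteq> sets lebesgue" using meas by (auto intro: fmeasurableD)
    show "decseq A"
    proof (rule decseq_SucI)
      fix n
      have "1 / real (Suc (Suc n)) \<le> 1 / real (Suc n)" by (intro divide_left_mono) auto
      then show "A (Suc n) \<subseteq> A n" unfolding A_def by (auto intro: le_less_trans simp del: of_nat_Suc)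
    qed
    show "emeasure lebesgue (A n) \<noteq> \<infinity>" for n using fmeasurableD2[OF meas] by simp
  qed
  moreover have "measure lebesgue (\<Inter>n. A n) = 0"
  proof -
    have "(\<Inter>n. A n) \<subseteq> {x. axis k 1 \<bullet> x = \<mu>}"
    proof
      fix x assume x: "x \<in> (\<Inter>n. A n)"
      have "\<mu> \<le> x $ k"
      proof (rule ccontr)
        assume "\<not> \<mu> \<le> x $ k"
        then obtain n where "inverse (real (Suc n)) < \<mu> - x $ k" using reals_Archimedean[of "\<mu> - x $ k"] by auto
        then show False using x by (auto simp: A_def inverse_eq_divide dest!: spec[of _ n])
      qed
      then show "x \<in> {x. axis k 1 \<bullet> x = \<mu>}" using x by (auto simp: A_def inner_axis')
    qed
    moreover have "negligible {x :: real ^ 'n. axis k 1 \<bullet> x = \<mu>}" by (intro negligible_hyperplane) simp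
    ultimately show ?thesis using negligible_subset negligible_imp_measure0 by blast
  qed
  ultimately have "\<forall>\<^sub>F n in sequentially. measure lebesgue (A n) < e"
    using e by (auto dest: order_tendstoD(2))
  then obtain n where "measure lebesgue (A n) < e" by (auto simp: eventually_sequentially)
  then show ?thesis by (intro that[of "1 / real (Suc n)"] meas[of n, unfolded A_def]) (simp_all add: A_def)
qed

text \<open>The difference is jointly continuous in \<open>\<mu>\<close> and \<open>x\<close>, so compactness of \<open>K\<close> and the tube
  lemma apply.\<close>
lemma W_positive_nearby:
  assumes K: "compact K" "K \<subseteq> cap \<mu>0" and \<mu>0: "0 < \<mu>0"
    and pos: "\<And>x. x \<in> K \<Longrightarrow> 0 < W \<mu>0 0 x"
  obtains \<eta> where "0 < \<eta>" "\<And>\<mu> x. \<bar>\<mu> - \<mu>0\<bar> < \<eta> \<Longrightarrow> x \<in> K \<Longrightarrow> 0 < W \<mu> 0 x"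
proof (cases "K = {}")
  case True
  then show ?thesis using that[of 1] by auto
next
  case False
  have m0: "0 < m" using m_pos by simp
  have O: "open (\<Omega> - {0})" using Omega(1) by (rule open_delete)
  define D where "D = (\<Omega> - {0}) \<times> UNIV \<inter> (\<lambda>z. reflect_at k (snd z) (fst z)) -` (\<Omega> - {0})"
  have refl_cont: "continuous_on A (\<lambda>z. reflect_at k (snd z) (fst z))" for A :: "((real ^ 'n) \<times> real) set"
    by (intro continuous_intros)
  have D: "open D" unfolding D_def
    by (rule continuous_open_preimage[OF refl_cont _ O]) (intro open_Times O open_UNIV)
  define \<phi> where "\<phi> z = W (snd z) 0 (fst z)" for z
  have "continuous_on D \<phi>"
    unfolding \<phi>_def W_def
    by (intro continuous_intros continuous_on_compose2[OF U_cont[OF m0]] refl_cont) (auto simp: D_def)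
  from continuous_open_preimage[OF this D, of "{0<..}"]
  have G: "open (D \<inter> \<phi> -` {0<..})" by simp
  have "(\<lambda>x. (x, \<mu>0)) ` K \<subseteq> (K \<times> UNIV) \<inter> (D \<inter> \<phi> -` {0<..})"
    using K(2) cap_cases[OF \<mu>0] pos by (force simp: D_def \<phi>_def)
  moreover have "openin (top_of_set (K \<times> UNIV)) ((K \<times> UNIV) \<inter> (D \<inter> \<phi> -` {0<..}))"
    using G by (rule openin_open_Int)
  ultimately obtain V where V: "openin (top_of_set UNIV) V" "\<mu>0 \<in> V"
    "K \<times> V \<subseteq> (K \<times> UNIV) \<inter> (D \<inter> \<phi> -` {0<..})"
    using tube_lemma[OF K(1) False] by metis
  then obtain \<eta> where \<eta>: "0 < \<eta>" "ball \<mu>0 \<eta> \<subseteq> V" by (auto simp: open_contains_ball)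
  show ?thesis
  proof (rule that[OF \<eta>(1)])
    fix \<mu> x assume "\<bar>\<mu> - \<mu>0\<bar> < \<eta>" "x \<in> K"
    then have "(x, \<mu>) \<in> K \<times> V" using \<eta>(2) by (auto simp: dist_real_def subset_iff abs_minus_commute)
    then show "0 < W \<mu> 0 x" using V(3) by (auto simp: \<phi>_def)
  qed
qed

text \<open>For \<open>\<mu>\<close> slightly above \<open>\<mu>0\<close> a given point \<open>x\<close> beyond the hyperplane \<open>x $ k = \<mu>0\<close> belongs to
  \<open>cap \<mu>\<close>. The value \<open>\<mu>0 = 0\<close> is included for the final comparison with the mirror image.\<close>
lemma W_limit_nonneg:
  assumes x: "x \<in> \<Omega>" "\<mu>0 < x $ k" and \<mu>0: "0 \<le> \<mu>0" and refl: "reflect_at k \<mu>0 x \<noteq> 0"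
    and good: "\<And>\<mu> x. \<mu>0 < \<mu> \<Longrightarrow> x \<in> cap \<mu> \<Longrightarrow> 0 \<le> W \<mu> 0 x"
  shows "0 \<le> W \<mu>0 0 x"
proof -
  have m0: "0 < m" using m_pos by simp
  have "reflect_at k \<mu>0 x \<in> \<Omega>"
    by (rule convex_symmetric_slice[OF conv sym x(1)]) (use x(2) \<mu>0 in auto)
  then have r: "reflect_at k \<mu>0 x \<in> \<Omega> - {0}" using refl by simp
  have "continuous_on UNIV (\<lambda>\<mu>. reflect_at k \<mu> x)" by (intro continuous_intros)
  then have lim: "((\<lambda>\<mu>. reflect_at k \<mu> x) \<longlongrightarrow> reflect_at k \<mu>0 x) (at_right \<mu>0)"
    by (auto simp: continuous_on_def intro: tendsto_within_subset)
  have "((\<lambda>\<mu>. W \<mu> 0 x) \<longlongrightarrow> W \<mu>0 0 x) (at_right \<mu>0)"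
    unfolding W_def by (intro tendsto_intros isCont_tendsto_compose[OF U_isCont[OF m0 r] lim])
  moreover have "\<forall>\<^sub>F \<mu> in at_right \<mu>0. 0 \<le> W \<mu> 0 x"
  proof -
    have "\<forall>\<^sub>F \<mu> in at_right \<mu>0. reflect_at k \<mu> x \<noteq> 0"
      using tendsto_imp_eventually_ne[OF lim refl] .
    moreover have "\<forall>\<^sub>F \<mu> in at_right \<mu>0. \<mu>0 < \<mu> \<and> \<mu> < x $ k"
      using x(2) by (auto simp: eventually_at_right)
    ultimately show ?thesis
      by eventually_elim (use good x(1) in \<open>auto simp: cap_iff\<close>)
  qed
  ultimately show ?thesis by (intro tendsto_lowerbound[of "\<lambda>\<mu>. W \<mu> 0 x"]) auto
qed

text \<open>The set of bad \<open>\<mu>\<close> is bounded above because caps beyond \<open>\<Omega>\<close> are empty. Its supremum is not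
  itself bad, by continuity from above, and for bad values just below it the negative set would have volume
  at most \<open>\<nu>\<close>: it avoids the compact set \<open>K\<close>, and the part of the cap outside \<open>K\<close> and the slab
  between the two hyperplanes are both thin.\<close>
lemma W_nonneg:
  assumes "0 < \<mu>" "x \<in> cap \<mu>"
  shows "0 \<le> W \<mu> 0 x"
proof (rule ccontr)
  assume neg: "\<not> 0 \<le> W \<mu> 0 x"
  define bad where "bad = {\<mu>. 0 < \<mu> \<and> (\<exists>x\<in>cap \<mu>. \<not> 0 \<le> W \<mu> 0 x)}"
  have \<mu>_bad: "\<mu> \<in> bad" using assms neg by (auto simp: bad_def)
  obtain b where b: "\<And>x. x \<in> \<Omega> \<Longrightarrow> norm x \<le> b" using Omega(2) by (auto simp: bounded_iff)
  have bdd: "bdd_above bad"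
  proof (rule bdd_aboveI)
    fix \<mu> assume "\<mu> \<in> bad"
    then obtain x where "x \<in> \<Omega>" "\<mu> < x $ k" by (auto simp: bad_def cap_iff)
    then show "\<mu> \<le> b" using b[of x] component_le_norm_cart[of x k] by linarith
  qed
  define \<mu>0 where "\<mu>0 = Sup bad"
  have \<mu>0: "0 < \<mu>0" using cSup_upper[OF \<mu>_bad bdd] assms(1) by (simp add: \<mu>0_def)
  have above: "0 \<le> W \<mu>' 0 y" if "\<mu>0 < \<mu>'" "y \<in> cap \<mu>'" for \<mu>' y
  proof (rule ccontr)
    assume "\<not> ?thesis"
    then have "\<mu>' \<in> bad" using that \<mu>0 by (auto simp: bad_def)
    then show False using cSup_upper[OF _ bdd, of \<mu>'] that by (simp add: \<mu>0_def)
  qed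
  have at_\<mu>0: "0 \<le> W \<mu>0 0 y" if "y \<in> cap \<mu>0" for y
  proof (rule W_limit_nonneg[OF _ _ _ _ above])
  qed (use that \<mu>0 in \<open>simp_all add: cap_iff\<close>)
  obtain \<nu> where \<nu>: "0 < \<nu>" "\<And>\<mu> x. 0 < \<mu> \<Longrightarrow> measure lebesgue {y \<in> cap \<mu>. W \<mu> 0 y < 0} \<le> \<nu>
      \<Longrightarrow> x \<in> cap \<mu> \<Longrightarrow> 0 \<le> W \<mu> 0 x"
    by (rule small_negative_set) (rule that; assumption)
  have cap_sub: "cap \<mu>0 \<subseteq> \<Omega>" by (auto simp: cap_iff)
  have cap_meas: "cap \<mu>0 \<in> sets lebesgue" using open_cap by (intro sets_completionI_sets) auto
  obtain K where K: "closed K" "K \<subseteq> cap \<mu>0" "cap \<mu>0 - K \<in> lmeasurable"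
      "emeasure lebesgue (cap \<mu>0 - K) < ennreal (\<nu> / 2)"
    using sets_lebesgue_inner_closed[OF cap_meas, of "\<nu> / 2"] \<nu>(1) by auto
  have K_meas: "measure lebesgue (cap \<mu>0 - K) < \<nu> / 2"
    using K(3,4) \<nu>(1) by (simp add: emeasure_eq_measure2 ennreal_less_iff)
  have K_compact: "compact K"
    using K(1,2) cap_sub Omega(2) by (meson bounded_subset compact_eq_bounded_closed order_trans)
  have K_pos: "0 < W \<mu>0 0 x" if "x \<in> K" for x
    using W_positive[OF \<mu>0 at_\<mu>0] K(2) that by blast
  obtain \<eta>1 where \<eta>1: "0 < \<eta>1" "\<And>\<mu> x. \<bar>\<mu> - \<mu>0\<bar> < \<eta>1 \<Longrightarrow> x \<in> K \<Longrightarrow> 0 < W \<mu> 0 x"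
    by (rule W_positive_nearby[OF K_compact K(2) \<mu>0 K_pos]) (assumption, (rule that; assumption))
  obtain \<eta>2 where \<eta>2: "0 < \<eta>2" "{x \<in> \<Omega>. \<mu>0 - \<eta>2 < x $ k \<and> x $ k \<le> \<mu>0} \<in> lmeasurable"
    "measure lebesgue {x \<in> \<Omega>. \<mu>0 - \<eta>2 < x $ k \<and> x $ k \<le> \<mu>0} < \<nu> / 2"
    using thin_slab[of "\<nu> / 2" \<mu>0] \<nu>(1) by auto
  let ?slab = "{x \<in> \<Omega>. \<mu>0 - \<eta>2 < x $ k \<and> x $ k \<le> \<mu>0}"
  have "\<mu>0 - min \<eta>1 \<eta>2 < Sup bad" using \<eta>1 \<eta>2 by (simp add: \<mu>0_def)
  then obtain \<mu>1 where \<mu>1: "\<mu>1 \<in> bad" "\<mu>0 - min \<eta>1 \<eta>2 < \<mu>1"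
    using less_cSup_iff[OF _ bdd] \<mu>_bad by blast
  have \<mu>1_le: "\<mu>1 \<le> \<mu>0" using cSup_upper[OF \<mu>1(1) bdd] by (simp add: \<mu>0_def)
  let ?N = "{y \<in> cap \<mu>1. W \<mu>1 0 y < 0}"
  have sub: "?N \<subseteq> (cap \<mu>0 - K) \<union> (?slab \<union> {reflect_at k \<mu>0 0})"
  proof
    fix y assume y: "y \<in> ?N"
    then have "y \<notin> K" using \<eta>1(2)[of \<mu>1 y] \<mu>1(2) \<mu>1_le by force
    then show "y \<in> (cap \<mu>0 - K) \<union> (?slab \<union> {reflect_at k \<mu>0 0})"
      using y \<mu>1(2) by (auto simp: cap_def)
  qed
  have "0 < \<mu>1" using \<mu>1(1) by (simp add: bad_def)
  then have N_open: "open ?N" using open_negative_set m_pos by simp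
  have sing: "{reflect_at k \<mu>0 0} \<in> lmeasurable"
    by (intro lmeasurable_compact) simp
  have "measure lebesgue ?N \<le> measure lebesgue ((cap \<mu>0 - K) \<union> (?slab \<union> {reflect_at k \<mu>0 0}))"
    using sub N_open K(3) \<eta>2(2) sing
    by (intro measure_mono_fmeasurable sets_completionI_sets fmeasurable.Un) auto
  also have "\<dots> \<le> measure lebesgue (cap \<mu>0 - K) + measure lebesgue (?slab \<union> {reflect_at k \<mu>0 0})"
    using K(3) \<eta>2(2) sing by (intro measure_Un_le sets.Un fmeasurableD) auto
  also have "measure lebesgue (?slab \<union> {reflect_at k \<mu>0 0}) \<le>
      measure lebesgue ?slab + measure lebesgue {reflect_at k \<mu>0 0}"
    using \<eta>2(2) sing by (intro measure_Un_le fmeasurableD)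
  finally have "measure lebesgue ?N \<le> \<nu>" using K_meas \<eta>2(3) by simp
  then have "\<And>x. x \<in> cap \<mu>1 \<Longrightarrow> 0 \<le> W \<mu>1 0 x" using \<nu>(2) \<open>0 < \<mu>1\<close> by blast
  then show False using \<mu>1(1) by (auto simp: bad_def)
qed

text \<open>The plane halfway between \<open>x\<close> and \<open>y\<close> reflects \<open>y\<close> to \<open>x\<close>.\<close>
lemma strictly_decreasing:
  assumes xy: "x \<in> \<Omega>" "y \<in> \<Omega>" "\<And>i. i \<noteq> k \<Longrightarrow> x $ i = y $ i" "0 < x $ k" "x $ k < y $ k"
  shows "U 0 y < U 0 x"
proof -
  define \<mu> where "\<mu> = (x $ k + y $ k) / 2"
  have r: "reflect_at k \<mu> y = x" using xy(3) by (auto simp: vec_eq_iff \<mu>_def field_simps)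
  have \<mu>: "0 < \<mu>" "\<mu> < y $ k" using xy(4,5) by (auto simp: \<mu>_def)
  have "y \<in> cap \<mu>" using xy(2,4) \<mu>(2) by (auto simp: cap_iff r)
  then have "0 < W \<mu> 0 y" using W_positive[OF \<mu>(1)] W_nonneg[OF \<mu>(1)] by blast
  then show ?thesis by (simp add: W_def r)
qed

lemma le_reflect:
  assumes "x \<in> \<Omega>" "0 < x $ k"
  shows "U 0 x \<le> U 0 (reflect k x)"
proof -
  have "(reflect_at k 0 x) $ k \<noteq> 0" using assms(2) by simp
  then have refl: "reflect_at k 0 x \<noteq> 0" by (metis zero_index)
  have "0 \<le> W 0 0 x" by (rule W_limit_nonneg[OF assms order_refl refl W_nonneg])
  then show ?thesis by (simp add: W_def reflect_eq_reflect_at)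
qed

lemma mirrored: "navier_system k m \<Omega> f L (\<lambda>j x. U j (reflect_at k 0 x))"
proof -
  have stable: "reflect_at k 0 x \<in> \<Omega>" if "x \<in> \<Omega>" for x
    using sym that unfolding symmetric_in_direction_def reflect_eq_reflect_at by blast
  have refl_in: "reflect_at k 0 x \<in> \<Omega> \<longleftrightarrow> x \<in> \<Omega>" for x
    using stable[of x] stable[of "reflect_at k 0 x"] by auto
  have refl_0: "reflect_at k 0 x = 0 \<longleftrightarrow> x = 0" for x by (auto simp: vec_eq_iff)
  have refl: "reflect_at k 0 x \<in> \<Omega> - {0}" if "x \<in> \<Omega> - {0}" for x
    using that by (simp add: refl_in refl_0)
  show ?thesis
  proof
    show "continuous_on (\<Omega> - {0}) (\<lambda>x. U j (reflect_at k 0 x))" if "j < m" for j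
      by (rule continuous_on_compose2[OF U_cont[OF that]]) (use refl in \<open>auto intro!: continuous_intros\<close>)
    show "has_laplacian (\<lambda>x. U j (reflect_at k 0 x)) x (- U (Suc j) (reflect_at k 0 x))"
      if "j < m" "x \<in> \<Omega> - {0}" for j x
      using U_lap[OF that(1) refl[OF that(2)]] by (rule has_laplacian_reflect_at)
    show "((\<lambda>x. U j (reflect_at k 0 x)) \<longlongrightarrow> 0) (at x within \<Omega> - {0})"
      if j: "j < m" and x: "x \<in> frontier \<Omega>" for j x
    proof -
      have xf: "x \<in> closure \<Omega>" "x \<notin> \<Omega>" using x Omega(1) by (auto simp: frontier_def interior_open)
      have "reflect_at k 0 ` closure \<Omega> \<subseteq> closure \<Omega>"
        by (rule image_closure_subset) (use refl_in closure_subset in \<open>auto intro!: continuous_intros\<close>)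
      then have rf: "reflect_at k 0 x \<in> frontier \<Omega>"
        using xf refl_in Omega(1) by (auto simp: frontier_def interior_open)
      have "(reflect_at k 0 \<longlongrightarrow> reflect_at k 0 x) (at x within \<Omega> - {0})"
        using isCont_reflect_at[where k = k and \<mu> = 0 and x = x] unfolding isCont_def by (rule tendsto_within_subset) simp
      moreover have "\<forall>\<^sub>F y in at x within \<Omega> - {0}. reflect_at k 0 y \<in> \<Omega> - {0} \<and> reflect_at k 0 y \<noteq> reflect_at k 0 x"
      proof -
        have "reflect_at k 0 y \<noteq> reflect_at k 0 x" if "y \<in> \<Omega>" for y
          using refl_in[of y] refl_in[of x] xf(2) that by auto
        then show ?thesis unfolding eventually_at_filter using refl by (intro always_eventually) auto
      qed
      ultimately have "filterlim (reflect_at k 0) (at (reflect_at k 0 x) within \<Omega> - {0}) (at x within \<Omega> - {0})"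
        by (simp add: filterlim_at)
      from filterlim_compose[OF U_frontier[OF j rf] this] show ?thesis .
    qed
    show "bdd_below ((\<lambda>x. U j (reflect_at k 0 x)) ` (\<Omega> - {0}))" if "j < m" for j
    proof -
      have "(\<lambda>x. U j (reflect_at k 0 x)) ` (\<Omega> - {0}) \<subseteq> U j ` (\<Omega> - {0})" using refl by blast
      with U_below[OF that] show ?thesis by (rule bdd_below_mono)
    qed
  qed (use dim m_pos Omega conv sym L_nonneg lip f_mono f_0 U_top U_pos refl in auto)
qed

lemma symmetric:
  assumes x: "x \<in> \<Omega> - {0}"
  shows "U 0 x = U 0 (reflect k x)"
proof -
  have rr: "reflect k (reflect k y) = y" for y by (simp add: reflect_eq_reflect_at)
  have eq: "U 0 y = U 0 (reflect k y)" if "y \<in> \<Omega>" "0 < y $ k" for y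
    using le_reflect[OF that] navier_system.le_reflect[OF mirrored that]
    by (simp add: reflect_eq_reflect_at)
  consider "0 < x $ k" | "x $ k = 0" | "0 < reflect k x $ k"
    by (cases rule: linorder_cases[of "x $ k" 0]) (auto simp: reflect_eq_reflect_at)
  then show ?thesis
  proof cases
    case 1
    then show ?thesis using eq x by simp
  next
    case 2
    then have "reflect k x = x" by (simp add: reflect_eq_reflect_at vec_eq_iff)
    then show ?thesis by simp
  next
    case 3
    have "reflect k x \<in> \<Omega>" using sym x by (simp add: symmetric_in_direction_def)
    then show ?thesis using eq[OF _ 3] by (simp add: rr)
  qed
qed

end

section \<open>Iterated Laplacians of smooth functions\<close>

lemma eventually_along_axis:
  assumes "open U" "x \<in> U"
  shows "\<forall>\<^sub>F t in nhds 0. x + t *\<^sub>R axis i (1::real) \<in> U"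
  using filterlim_along_axis[of x i] eventually_nhds_in_open[OF assms] by (auto simp: filterlim_iff)

lemma partial_deriv_cong:
  assumes "open U" "x \<in> U" "\<And>y. y \<in> U \<Longrightarrow> v y = w y"
  shows "partial_deriv i v x = partial_deriv i w x"
  unfolding partial_deriv_def
  by (rule deriv_cong_ev)
    (use eventually_mono[OF eventually_along_axis[OF assms(1,2), of i] assms(3)] in auto)

lemma Ck_on_partial:
  assumes "Ck_on n U v" "length is < n" "x \<in> U"
  shows "((\<lambda>t. partials is v (x + t *\<^sub>R axis i 1)) has_real_derivative partials (i # is) v x) (at 0)"
  using assms unfolding Ck_on_def by (auto simp: partial_deriv_def DERIV_deriv_iff_real_differentiable)

lemma neg_laplacian_partials: "neg_laplacian v x = - (\<Sum>i\<in>UNIV. partials [i, i] v x)"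
  by (simp add: neg_laplacian_def)

text \<open>A partial derivative depends on nearby values, so the formula is proved on all of the open set
  before the next derivative is taken; the same formula gives differentiability and continuity.\<close>
lemma
  assumes C: "Ck_on (Suc (Suc n)) U v" and U: "open U"
  shows partials_neg_laplacian:
    "length is \<le> n \<Longrightarrow> x \<in> U \<Longrightarrow> partials is (neg_laplacian v) x = - (\<Sum>i\<in>UNIV. partials (is @ [i, i]) v x)"
    and Ck_on_neg_laplacian: "Ck_on n U (neg_laplacian v)"
proof -
  have der: "((\<lambda>t. - (\<Sum>i\<in>UNIV. partials (is @ [i, i]) v (x + t *\<^sub>R axis j 1))) has_real_derivative
      - (\<Sum>i\<in>UNIV. partials (j # is @ [i, i]) v x)) (at 0)" if "length is < n" "x \<in> U" for "is" j x
    using that by (intro DERIV_minus DERIV_sum Ck_on_partial[OF C]) auto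
  have eq: "length is \<le> n \<Longrightarrow> x \<in> U \<Longrightarrow>
      partials is (neg_laplacian v) x = - (\<Sum>i\<in>UNIV. partials (is @ [i, i]) v x)" for "is" x
  proof (induction "is" arbitrary: x)
    case Nil
    then show ?case by (simp add: neg_laplacian_def)
  next
    case (Cons j "is")
    have "partial_deriv j (partials is (neg_laplacian v)) x =
        partial_deriv j (\<lambda>y. - (\<Sum>i\<in>UNIV. partials (is @ [i, i]) v y)) x"
      by (rule partial_deriv_cong[OF U]) (use Cons in auto)
    also have "\<dots> = - (\<Sum>i\<in>UNIV. partials (j # is @ [i, i]) v x)"
      unfolding partial_deriv_def using Cons.prems by (intro DERIV_imp_deriv der) auto
    finally show ?case by simp
  qed
  show "length is \<le> n \<Longrightarrow> x \<in> U \<Longrightarrow>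
      partials is (neg_laplacian v) x = - (\<Sum>i\<in>UNIV. partials (is @ [i, i]) v x)"
    by (rule eq)
  show "Ck_on n U (neg_laplacian v)"
    unfolding Ck_on_def
  proof (intro conjI allI impI ballI)
    fix "is" :: "'a list" and j x assume len: "length is < n" "x \<in> U"
    have ev: "\<forall>\<^sub>F t in nhds 0. partials is (neg_laplacian v) (x + t *\<^sub>R axis j 1) =
        - (\<Sum>i\<in>UNIV. partials (is @ [i, i]) v (x + t *\<^sub>R axis j 1))"
      using eventually_along_axis[OF U len(2), of j] by eventually_elim (use eq len in auto)
    have "((\<lambda>t. partials is (neg_laplacian v) (x + t *\<^sub>R axis j 1)) has_real_derivative
        - (\<Sum>i\<in>UNIV. partials (j # is @ [i, i]) v x)) (at 0)"
      using der[OF len, of j] DERIV_cong_ev[OF refl ev refl] by blast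
    then show "(\<lambda>t. partials is (neg_laplacian v) (x + t *\<^sub>R axis j 1)) differentiable (at 0)"
      by (auto simp: real_differentiable_def)
  next
    fix "is" :: "'a list" assume len: "length is \<le> n"
    have "continuous_on U (\<lambda>x. - (\<Sum>i\<in>UNIV. partials (is @ [i, i]) v x))"
      using C len unfolding Ck_on_def by (intro continuous_intros) auto
    then show "continuous_on U (partials is (neg_laplacian v))"
      using eq[OF len] by (simp cong: continuous_on_cong)
  qed
qed

lemma Ck_on_has_laplacian:
  assumes C: "Ck_on 2 U v" and U: "open U" and x: "x \<in> U"
  shows "has_laplacian v x (- neg_laplacian v x)"
proof -
  have "has_second_deriv (\<lambda>t. v (x + t *\<^sub>R axis i 1)) (partials [i, i] v x)" for i
    unfolding has_second_deriv_def
  proof (intro exI conjI)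
    show "\<forall>\<^sub>F t in nhds 0. ((\<lambda>t. v (x + t *\<^sub>R axis i 1)) has_real_derivative
        partials [i] v (x + t *\<^sub>R axis i 1)) (at t)"
      using eventually_along_axis[OF U x, of i]
    proof eventually_elim
      case (elim t)
      from Ck_on_partial[OF C _ elim, of "[]" i]
      have "((\<lambda>s. v (x + (s + t) *\<^sub>R axis i 1)) has_real_derivative partials [i] v (x + t *\<^sub>R axis i 1)) (at 0)"
        by (simp add: algebra_simps)
      then show ?case
        using DERIV_shift[of "\<lambda>s. v (x + s *\<^sub>R axis i 1)" "partials [i] v (x + t *\<^sub>R axis i 1)" 0 t] by simp
    qed
    show "((\<lambda>t. partials [i] v (x + t *\<^sub>R axis i 1)) has_real_derivative partials [i, i] v x) (at 0)"
      by (rule Ck_on_partial[OF C _ x]) simp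
  qed
  then show ?thesis unfolding has_laplacian_def neg_laplacian_partials
    by (intro exI[of _ "\<lambda>i. partials [i, i] v x"]) simp
qed

text \<open>The part of \<^const>\<open>Ck_upto\<close> at a single boundary point which, unlike continuity of the function
  itself on the larger set, is inherited by Laplacians.\<close>
definition partials_converge :: "nat \<Rightarrow> (real ^ 'n::finite) set \<Rightarrow> real ^ 'n \<Rightarrow> (real ^ 'n \<Rightarrow> real) \<Rightarrow> bool" where
  "partials_converge n U x v \<longleftrightarrow> (\<forall>is. length is \<le> n \<longrightarrow> (\<exists>l. (partials is v \<longlongrightarrow> l) (at x within U)))"

lemma partials_converge_neg_laplacian:
  assumes C: "Ck_on (Suc (Suc n)) U v" and U: "open U" and L: "partials_converge (Suc (Suc n)) U x v"
  shows "partials_converge n U x (neg_laplacian v)"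
  unfolding partials_converge_def
proof (intro allI impI)
  fix "is" :: "'a list" assume len: "length is \<le> n"
  have "\<forall>i. \<exists>l. (partials (is @ [i, i]) v \<longlongrightarrow> l) (at x within U)"
    using L len unfolding partials_converge_def by simp
  then obtain l where "\<And>i. (partials (is @ [i, i]) v \<longlongrightarrow> l i) (at x within U)" by metis
  then have "((\<lambda>y. - (\<Sum>i\<in>UNIV. partials (is @ [i, i]) v y)) \<longlongrightarrow> - (\<Sum>i\<in>UNIV. l i)) (at x within U)"
    by (intro tendsto_intros)
  moreover have "\<forall>\<^sub>F y in at x within U. - (\<Sum>i\<in>UNIV. partials (is @ [i, i]) v y) = partials is (neg_laplacian v) y"
    using partials_neg_laplacian[OF C U len] by (auto simp: eventually_at_filter)
  ultimately show "\<exists>l. (partials is (neg_laplacian v) \<longlongrightarrow> l) (at x within U)"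
    using Lim_transform_eventually by blast
qed

lemma Ck_upto_partials_converge:
  assumes "Ck_upto n U T v" "U \<subseteq> T" "x \<in> T"
  shows "partials_converge n U x v"
  unfolding partials_converge_def
proof (intro allI impI exI)
  fix "is" :: "'a list" assume "length is \<le> n"
  then have "continuous_on T (cont_ext U (partials is v))" using assms(1) by (simp add: Ck_upto_def)
  then have "(cont_ext U (partials is v) \<longlongrightarrow> cont_ext U (partials is v) x) (at x within U)"
    using assms(2,3) by (auto simp: continuous_on_def intro: tendsto_within_subset)
  moreover have "\<forall>\<^sub>F y in at x within U. cont_ext U (partials is v) y = partials is v y"
    by (auto simp: eventually_at_filter cont_ext_def)
  ultimately show "(partials is v \<longlongrightarrow> cont_ext U (partials is v) x) (at x within U)"
    by (rule Lim_transform_eventually)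
qed

lemma Ck_on_iterated_neg_laplacian:
  assumes "Ck_on (2 * m) U v" "open U" "j \<le> m"
  shows "Ck_on (2 * (m - j)) U ((neg_laplacian ^^ j) v)"
  using assms(3)
proof (induction j)
  case (Suc j)
  have "2 * (m - j) = Suc (Suc (2 * (m - Suc j)))" using Suc.prems by simp
  then show ?case using Suc Ck_on_neg_laplacian[of "2 * (m - Suc j)" U, OF _ assms(2)] by simp
qed (use assms in simp)

lemma partials_converge_iterated_neg_laplacian:
  assumes "Ck_on (2 * m) U v" "open U" "partials_converge (2 * m - 2) U x v" "j < m"
  shows "partials_converge (2 * m - 2 - 2 * j) U x ((neg_laplacian ^^ j) v)"
  using assms(4)
proof (induction j)
  case (Suc j)
  define n where "n = 2 * m - 2 - 2 * Suc j"
  have n: "2 * m - 2 - 2 * j = Suc (Suc n)" using Suc.prems by (simp add: n_def)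
  have "Ck_on (2 * (m - j)) U ((neg_laplacian ^^ j) v)"
    by (rule Ck_on_iterated_neg_laplacian[OF assms(1,2)]) (use Suc.prems in simp)
  then have "Ck_on (Suc (Suc n)) U ((neg_laplacian ^^ j) v)"
    unfolding Ck_on_def using Suc.prems by (auto simp: n_def)
  from partials_converge_neg_laplacian[OF this assms(2)] Suc n show ?case by (simp add: n_def)
qed (use assms in simp)

section \<open>The symmetry theorem\<close>

theorem theorem1p1:
  fixes k :: "'n::finite"
    and m :: nat
    and \<Omega> :: "(real ^ 'n) set"
    and f :: "real \<Rightarrow> real"
    and u :: "real ^ 'n \<Rightarrow> real"
  assumes n: "CARD('n) \<ge> 2"
    and m: "m \<ge> 1"
    and Omega: "open \<Omega>" "bounded \<Omega>" "connected \<Omega>" "0 \<in> \<Omega>"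
    and Omega_convex: "convex_in_direction k \<Omega>"
    and Omega_symmetric: "symmetric_in_direction k \<Omega>"
    and f_Lipschitz: "\<exists>L. L-lipschitz_on {0..} f"
    and f_mono: "mono_on {0..} f"
    and f_0: "f 0 \<ge> 0"
    and u_interior: "Ck_on (2 * m) (\<Omega> - {0}) u"
    and u_closure: "Ck_upto (2 * m - 2) (\<Omega> - {0}) (closure \<Omega> - {0}) u"
    and equation: "\<forall>x\<in>\<Omega> - {0}. (neg_laplacian ^^ m) u x = f (u x)"
    and positive: "\<forall>x\<in>\<Omega> - {0}. u x > 0"
    and boundary: "\<forall>j<m. \<forall>x\<in>frontier \<Omega>. cont_ext (\<Omega> - {0}) ((neg_laplacian ^^ j) u) x = 0"
    and below: "\<forall>j\<in>{1..m - 1}. bdd_below ((neg_laplacian ^^ j) u ` (\<Omega> - {0}))"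
  shows "(\<forall>x\<in>\<Omega> - {0}. u x = u (reflect k x)) \<and>
         (\<forall>x\<in>\<Omega>. \<forall>y\<in>\<Omega>. (\<forall>i. i \<noteq> k \<longrightarrow> x $ i = y $ i) \<and> 0 < x $ k \<and> x $ k < y $ k
            \<longrightarrow> u y < u x)"
proof -
  define V where "V = \<Omega> - {0}"
  define U where "U j = (neg_laplacian ^^ j) u" for j
  have V: "open V" unfolding V_def using Omega(1) by (rule open_delete)
  obtain L where L: "L-lipschitz_on {0..} f" using f_Lipschitz by blast
  have C: "Ck_on (2 * (m - j)) V (U j)" if "j \<le> m" for j
    using Ck_on_iterated_neg_laplacian[OF u_interior[folded V_def] V that] by (simp add: U_def)
  have C2: "Ck_on 2 V (U j)" if "j < m" for j
  proof -
    have "2 \<le> 2 * (m - j)" using that by simp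
    then show ?thesis using C[of j] that unfolding Ck_on_def by auto
  qed
  interpret navier_system k m \<Omega> f L U
  proof
    show "continuous_on (\<Omega> - {0}) (U j)" if "j < m" for j
      using C2[OF that] unfolding Ck_on_def V_def by (metis list.size(3) partials.simps(1) zero_le)
    show "has_laplacian (U j) x (- U (Suc j) x)" if "j < m" "x \<in> \<Omega> - {0}" for j x
      using Ck_on_has_laplacian[OF C2[OF that(1)] V] that(2) by (simp add: V_def U_def)
    show "(U j \<longlongrightarrow> 0) (at x within \<Omega> - {0})" if j: "j < m" and x: "x \<in> frontier \<Omega>" for j x
    proof -
      have xc: "x \<in> closure \<Omega>" "x \<notin> \<Omega>" using x Omega(1) by (auto simp: frontier_def interior_open)
      then have "x \<in> closure \<Omega> - {0}" using Omega(4) by auto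
      then have "partials_converge (2 * m - 2) V x u"
        using Ck_upto_partials_converge[OF u_closure] closure_subset[of \<Omega>] by (auto simp: V_def)
      from partials_converge_iterated_neg_laplacian[OF u_interior[folded V_def] V this j]
      obtain l where l: "(U j \<longlongrightarrow> l) (at x within V)"
        unfolding partials_converge_def U_def by (metis list.size(3) partials.simps(1) zero_le)
      have "x islimpt \<Omega>" using xc by (auto simp: closure_def)
      then have "x islimpt V"
        using islimpt_insert[of x 0 V] Omega(4) by (simp add: V_def insert_absorb)
      then have "Lim (at x within V) (U j) = l" using l by (intro tendsto_Lim) (auto simp: trivial_limit_within)
      moreover have "Lim (at x within V) (U j) = 0"
        using boundary[rule_format, OF j x] xc(2) by (simp add: cont_ext_def V_def U_def)
      ultimately show ?thesis using l by (simp add: V_def)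
    qed
    show "bdd_below (U j ` (\<Omega> - {0}))" if "j < m" for j
    proof (cases "j = 0")
      case True
      then show ?thesis using positive by (intro bdd_belowI2[of _ 0]) (auto simp: U_def less_imp_le)
    next
      case False
      then show ?thesis using below that by (auto simp: U_def)
    qed
    show "\<bar>f a - f b\<bar> \<le> L * \<bar>a - b\<bar>" if "0 \<le> a" "0 \<le> b" for a b
      using lipschitz_onD[OF L, of a b] that by (simp add: dist_real_def)
    show "f a \<le> f b" if "0 \<le> a" "a \<le> b" for a b using mono_onD[OF f_mono, of a b] that by simp
  qed (use n m Omega Omega_convex Omega_symmetric f_0 equation positive lipschitz_on_nonneg[OF L]
      in \<open>auto simp: U_def\<close>)
  show ?thesis using symmetric strictly_decreasing by (auto simp: U_def)
qed

end
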